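(* Let $n,d,k\in\omega\setminus\{0\}$ with $d\le n$. Then: (a) $h_{SR}(n,d,k)=h_{AD}(n,d,k)=h_{ESR}(n,d,k)=h_{EAD}(n,d,k)=0$. (b) If $k=1$ or $d=1$, then $h_{AR}(n,d,k)=h_{EAR}(n,d,k)=n$. If $k\ge 2$ and $d\ge 2$, then \[ \max\left\{d,\frac{n(k-1)}{k^d}\right\}\le h_{AR}(n,d,k)\le h_{EAR}(n,d,k)\le d+\frac{n}{k^{d-1}}. \] (c) $h^R_{SR}(n,d,k)=h^R_{AD}(n,d,k)$, and this common value equals $n$ if $d=n$ and $1$ if $d\ne n$. (d) $\max\left\{d,\frac{(nk)^{1/d}}{k}-d\right\}\le h^R_{ESR}(n,d,k)\le 2d\left\lceil\frac{(nk)^{1/d}}{k}\right\rceil$. (e) $\max\left\{d,\frac{(nk)^{1/d}}{k}-d\right\}\le h^R_{EAD}(n,d,k)\le 2d\left\lceil\frac{(nk)^{1/d}}{k}\right\rceil$.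
   Context: Let $\omega=\{0,1,2,\dots\}$ and let $\{a_i:i\in\omega\}$ be a set of attributes. A decision rule $r$ is an expression $(a_{i_1}=\delta_1)\wedge\cdots\wedge(a_{i_m}=\delta_m)\to\sigma$ with $m\in\omega$, pairwise different attributes $a_{i_1},\dots,a_{i_m}$, and $\delta_1,\dots,\delta_m,\sigma\in\omega$; $m$ is its length, $\sigma$ its right-hand side, $A(r)=\{a_{i_1},\dots,a_{i_m}\}$ and $K(r)=\{a_{i_1}=\delta_1,\dots,a_{i_m}=\delta_m\}$ (both empty if $m=0$). Two rules are equal iff they have the same $K(\cdot)$ and the same right-hand side. A decision rule system $S$ is a finite nonempty set of decision rules; $\Sigma$ is the set of all such systems. Let $A(S)=\bigcup_{r\in S}A(r)$, $n(S)=|A(S)|$, $D(Z)$ = set of right-hand sides of rules in $Z\subseteq S$, $d(S)$ = maximum length of a rule in $S$. For $a_i\in A(S)$, $V_S(a_i)=\{\delta:(a_i=\delta)\in\bigcup_{r\in S}K(r)\}$ and $EV_S(a_i)=V_S(a_i)\cup\{*\}$, where $*$ is a symbol not in $\omega$. $k(S)=\max\{|V_S(a_i)|:a_i\in A(S)\}$ if $n(S)>0$, and $k(S)=0$ if $n(S)=0$. A set of equations $\{a_{i_1}=\delta_1,\dots,a_{i_m}=\delta_m\}$ with $\delta_j\in\omega\cup\{*\}$ is inconsistent if there are $l\neq t$ with $i_l=i_t$ and $\delta_l\ne\delta_t$, and consistent otherwise. A decision tree over $S$ is a finite directed rooted tree in which each working (non-terminal) node is labeled with an attribute from $A(S)$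 and each terminal node is labeled with a subset of $S$. In an o-tree, a working node labeled $a_i$ has exactly $|V_S(a_i)|$ outgoing edges, labeled with pairwise distinct elements of $V_S(a_i)$. In an e-tree, it has exactly $|EV_S(a_i)|$ outgoing edges, labeled with pairwise distinct elements of $EV_S(a_i)$. For a complete path $\xi$ (from the root to a terminal node), $K(\xi)$ is the set of equations $a_i=\delta$ such that $a_i$ labels a working node of $\xi$ and $\delta$ labels the edge of $\xi$ leaving that node. $\tau(\xi)$ is the set of rules labeling the terminal node of $\xi$, and $h(\xi)$ is the number of working nodes of $\xi$. The depth $h(\Gamma)$ is the maximum of $h(\xi)$ over all complete paths. An o-tree (resp. e-tree) $\Gamma$ over $S$ solves $AR(S)$ (resp. $EAR(S)$) if every complete path $\xi$ with $K(\xi)$ consistent satisfies: $K(r)\subseteq K(\xi)$ for all $r\in\tau(\xi)$, and $K(r)\cup K(\xi)$ is inconsistent for all $r\in S\setminus\tau(\xi)$. It solves $AD(S)$ (resp. $EAD(S)$) if every such $\xi$ satisfies: $K(r)\subseteq K(\xi)$ for all $r\in\tau(\xi)$, and $K(r)\cup K(\xi)$ is inconsistent for every $r\in S\setminus\tau(\xi)$ whose right-hand side does not belong to $D(\tau(\xi))$. It solves $SR(S)$ (resp. $ESR(S)$) if every such $\xi$ satisfies: $K(r)\subseteq K(\xi)$ for all $r\in\tau(\xi)$, and if $\tau(\xi)=\emptyset$ then $K(r)\cup K(\xi)$ is inconsistent for every $r\in S$. For $C\in\{AR,EAR,AD,EAD,SR,ESR\}$, $h_C(S)$ is the minimum depth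 of a decision tree over $S$ solving $C(S)$. If $n(S)=0$, this is $0$. $R_{SR}(S)$ is the set of $r\in S$ for which there is no $r'\in S$ with $K(r')\subsetneq K(r)$, and $S$ is SR-reduced if $R_{SR}(S)=S$. $R_{AD}(S)$ is the set of $r\in S$ for which there is no $r'\in S$ with the same right-hand side as $r$ and $K(r')\subsetneq K(r)$, and $S$ is AD-reduced if $R_{AD}(S)=S$. $\Sigma_{SR}$ and $\Sigma_{AD}$ denote the sets of SR-reduced and AD-reduced systems, respectively. For $C\in\{SR,ESR,AD,EAD,AR,EAR\}$ and $n,d,k\in\omega\setminus\{0\}$ with $d\le n$: $h_C(n,d,k)=\min\{h_C(S):S\in\Sigma,\ n(S)=n,\ d(S)=d,\ k(S)=k\}$. For $C\in\{SR,ESR,AD,EAD\}$, let $C'=SR$ if $C\in\{SR,ESR\}$ and $C'=AD$ if $C\in\{AD,EAD\}$. Then $h^R_C(n,d,k)$ is the same minimum taken over $S\in\Sigma_{C'}$. *)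

theory Defs
  imports Complex_Main
begin

section \<open>Decision rule systems\<close>

text \<open>The attribute \<open>a\<^sub>i\<close> is represented by its index \<open>i\<close>, an equation \<open>a\<^sub>i = \<delta>\<close> by the pair
  \<open>(i, \<delta>)\<close>. As rules are identified by their equation set and right-hand side, a rule is
  just this pair of data. A set of equations is consistent iff it is single-valued as a relation.\<close>

abbreviation consistent :: "('a \<times> 'b) set \<Rightarrow> bool" where
  "consistent E \<equiv> single_valued E"

datatype rule = Rule (eqs: "(nat \<times> nat) set") (rhs: nat)

definition is_rule :: "rule \<Rightarrow> bool" where
  "is_rule r \<longleftrightarrow> finite (eqs r) \<and> consistent (eqs r)"

definition rule_systems :: "rule set set" where
  "rule_systems = {S. finite S \<and> S \<noteq> {} \<and> (\<forall>r\<in>S. is_rule r)}"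

definition attrs :: "rule set \<Rightarrow> nat set" where
  "attrs S = (\<Union>r\<in>S. fst ` eqs r)"

definition n_of :: "rule set \<Rightarrow> nat" where
  "n_of S = card (attrs S)"

definition d_of :: "rule set \<Rightarrow> nat" where
  "d_of S = Max ((\<lambda>r. card (eqs r)) ` S)"

definition vals :: "rule set \<Rightarrow> nat \<Rightarrow> nat set" where
  "vals S a = {\<delta>. (a, \<delta>) \<in> (\<Union>r\<in>S. eqs r)}"

definition k_of :: "rule set \<Rightarrow> nat" where
  "k_of S = (if n_of S > 0 then Max ((\<lambda>a. card (vals S a)) ` attrs S) else 0)"

definition SR_reduced :: "rule set \<Rightarrow> bool" where
  "SR_reduced S \<longleftrightarrow> {r \<in> S. \<not> (\<exists>r'\<in>S. eqs r' \<subset> eqs r)} = S"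

definition AD_reduced :: "rule set \<Rightarrow> bool" where
  "AD_reduced S \<longleftrightarrow> {r \<in> S. \<not> (\<exists>r'\<in>S. rhs r' = rhs r \<and> eqs r' \<subset> eqs r)} = S"

section \<open>Decision trees\<close>

text \<open>Edge labels have type \<^typ>\<open>nat option\<close>, where \<^term>\<open>None\<close> stands for the extra symbol \<open>*\<close>.
  The function \<open>ext_eqs\<close> embeds the equations of a rule into this extended setting.\<close>

definition ext_eqs :: "rule \<Rightarrow> (nat \<times> nat option) set" where
  "ext_eqs r = {(a, Some \<delta>) | a \<delta>. (a, \<delta>) \<in> eqs r}"

definition o_labels :: "rule set \<Rightarrow> nat \<Rightarrow> nat option set" where
  "o_labels S a = Some ` vals S a"

definition e_labels :: "rule set \<Rightarrow> nat \<Rightarrow> nat option set" where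
  "e_labels S a = insert None (Some ` vals S a)"

datatype dtree = Terminal "rule set" | Working nat "(nat option \<times> dtree) list"

inductive tree_over :: "(nat \<Rightarrow> nat option set) \<Rightarrow> rule set \<Rightarrow> dtree \<Rightarrow> bool"
  for L :: "nat \<Rightarrow> nat option set" and S :: "rule set" where
  terminal: "Z \<subseteq> S \<Longrightarrow> tree_over L S (Terminal Z)"
| working: "\<lbrakk>a \<in> attrs S; length es = card (L a); distinct (map fst es); fst ` set es \<subseteq> L a;
     \<forall>e\<in>set es. tree_over L S (snd e)\<rbrakk> \<Longrightarrow> tree_over L S (Working a es)"

definition o_tree :: "rule set \<Rightarrow> dtree \<Rightarrow> bool" where
  "o_tree S = tree_over (o_labels S) S"

definition e_tree :: "rule set \<Rightarrow> dtree \<Rightarrow> bool" where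
  "e_tree S = tree_over (e_labels S) S"

text \<open>\<open>complete_path \<Gamma> \<xi> Z\<close>: the list \<open>\<xi>\<close> of (node label, edge label) pairs is read along a path
  of \<open>\<Gamma>\<close> from the root to a terminal node labeled \<open>Z\<close>. Thus \<open>set \<xi>\<close> is the equation set
  of the path, \<open>length \<xi>\<close> its number of working nodes and \<open>Z\<close> its \<open>\<tau>(\<xi>)\<close>.\<close>

inductive complete_path :: "dtree \<Rightarrow> (nat \<times> nat option) list \<Rightarrow> rule set \<Rightarrow> bool" where
  terminal: "complete_path (Terminal Z) [] Z"
| working: "\<lbrakk>(\<delta>, \<Gamma>) \<in> set es; complete_path \<Gamma> \<xi> Z\<rbrakk>
    \<Longrightarrow> complete_path (Working a es) ((a, \<delta>) # \<xi>) Z"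

definition depth :: "dtree \<Rightarrow> nat" where
  "depth \<Gamma> = Max {length \<xi> | \<xi> Z. complete_path \<Gamma> \<xi> Z}"

section \<open>Problems\<close>

definition AR_correct :: "rule set \<Rightarrow> dtree \<Rightarrow> bool" where
  "AR_correct S \<Gamma> \<longleftrightarrow> (\<forall>\<xi> Z. complete_path \<Gamma> \<xi> Z \<and> consistent (set \<xi>) \<longrightarrow>
     (\<forall>r\<in>Z. ext_eqs r \<subseteq> set \<xi>) \<and>
     (\<forall>r\<in>S - Z. \<not> consistent (ext_eqs r \<union> set \<xi>)))"

definition AD_correct :: "rule set \<Rightarrow> dtree \<Rightarrow> bool" where
  "AD_correct S \<Gamma> \<longleftrightarrow> (\<forall>\<xi> Z. complete_path \<Gamma> \<xi> Z \<and> consistent (set \<xi>) \<longrightarrow>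
     (\<forall>r\<in>Z. ext_eqs r \<subseteq> set \<xi>) \<and>
     (\<forall>r\<in>S - Z. rhs r \<notin> rhs ` Z \<longrightarrow> \<not> consistent (ext_eqs r \<union> set \<xi>)))"

definition SR_correct :: "rule set \<Rightarrow> dtree \<Rightarrow> bool" where
  "SR_correct S \<Gamma> \<longleftrightarrow> (\<forall>\<xi> Z. complete_path \<Gamma> \<xi> Z \<and> consistent (set \<xi>) \<longrightarrow>
     (\<forall>r\<in>Z. ext_eqs r \<subseteq> set \<xi>) \<and>
     (Z = {} \<longrightarrow> (\<forall>r\<in>S. \<not> consistent (ext_eqs r \<union> set \<xi>))))"

datatype problem = SR | ESR | AD | EAD | AR | EAR

fun solves :: "problem \<Rightarrow> rule set \<Rightarrow> dtree \<Rightarrow> bool" where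
  "solves SR S \<Gamma> \<longleftrightarrow> o_tree S \<Gamma> \<and> SR_correct S \<Gamma>"
| "solves ESR S \<Gamma> \<longleftrightarrow> e_tree S \<Gamma> \<and> SR_correct S \<Gamma>"
| "solves AD S \<Gamma> \<longleftrightarrow> o_tree S \<Gamma> \<and> AD_correct S \<Gamma>"
| "solves EAD S \<Gamma> \<longleftrightarrow> e_tree S \<Gamma> \<and> AD_correct S \<Gamma>"
| "solves AR S \<Gamma> \<longleftrightarrow> o_tree S \<Gamma> \<and> AR_correct S \<Gamma>"
| "solves EAR S \<Gamma> \<longleftrightarrow> e_tree S \<Gamma> \<and> AR_correct S \<Gamma>"

section \<open>Minimum depths\<close>

text \<open>Each minimum below is a \<open>LEAST\<close> over natural numbers, so it is only determined when the
  underlying set is nonempty. This is the case for the arguments of interest: querying all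
  attributes one after the other solves every problem, and (reduced) systems with parameters
  \<open>0 < d \<le> n\<close> and \<open>k > 0\<close> exist.\<close>

definition h :: "problem \<Rightarrow> rule set \<Rightarrow> nat" where
  "h C S = (if n_of S = 0 then 0 else (LEAST m. \<exists>\<Gamma>. solves C S \<Gamma> \<and> depth \<Gamma> = m))"

definition h_min :: "problem \<Rightarrow> nat \<Rightarrow> nat \<Rightarrow> nat \<Rightarrow> nat" where
  "h_min C n d k =
     (LEAST m. \<exists>S\<in>rule_systems. n_of S = n \<and> d_of S = d \<and> k_of S = k \<and> h C S = m)"

text \<open>The notion of reducedness belonging to a problem; deliberately left undefined
  for \<open>AR\<close> and \<open>EAR\<close>.\<close>

fun reduced_for :: "problem \<Rightarrow> rule set \<Rightarrow> bool" where
  "reduced_for SR S = SR_reduced S"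
| "reduced_for ESR S = SR_reduced S"
| "reduced_for AD S = AD_reduced S"
| "reduced_for EAD S = AD_reduced S"

definition hR_min :: "problem \<Rightarrow> nat \<Rightarrow> nat \<Rightarrow> nat \<Rightarrow> nat" where
  "hR_min C n d k =
     (LEAST m. \<exists>S\<in>rule_systems. reduced_for C S \<and>
        n_of S = n \<and> d_of S = d \<and> k_of S = k \<and> h C S = m)"

end

theory Submission
  imports Defs "HOL-Library.FuncSet"
begin

text \<open>
  A tree of depth at most \<open>m\<close> solving a problem amounts to an \<open>m\<close>-step winning strategy in a query game, and
  every answer function produces a play of this game. Lower bounds come from suitable answers.
  A rule of maximal length forces \<open>d\<close> queries. Averaging over all assignments gives
  \<open>n \<le> h_AR * k ^ (d - 1)\<close>, which also covers \<open>k = 1\<close> and \<open>d = 1\<close>. For reduced systems and trees with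
  \<open>*\<close>-edges, answering according to a proper subset \<open>E\<close> of the equations of a rule and \<open>*\<close> elsewhere
  makes the tree query a further attribute of that rule; iterating over \<open>E\<close> reaches all attributes in
  \<open>d\<close> rounds, with branching \<open>h * k\<close>.

  The upper bounds for \<open>EAR\<close>, \<open>ESR\<close> and \<open>EAD\<close> come from systems in which the answers at \<open>(d - 1) * t\<close>
  common attributes select one small block of the remaining attributes, with \<open>t = 1\<close> for \<open>EAR\<close>.
\<close>

section \<open>Trees as query strategies\<close>

definition labels :: "problem \<Rightarrow> rule set \<Rightarrow> nat \<Rightarrow> nat option set" where
  "labels C S = (if C \<in> {ESR, EAD, EAR} then e_labels S else o_labels S)"

text \<open>Says when a listed rule \<open>r'\<close> excuses \<open>r\<close> from being refuted:
  only \<open>r\<close> itself for AR, an equal right-hand side for AD, any rule for SR. This one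
  relation lets the six problems share their proofs.\<close>

definition covers :: "problem \<Rightarrow> rule \<Rightarrow> rule \<Rightarrow> bool" where
  "covers C r r' \<longleftrightarrow> (C \<in> {AR, EAR} \<longrightarrow> r' = r) \<and> (C \<in> {AD, EAD} \<longrightarrow> rhs r' = rhs r)"

definition terminal_ok :: "problem \<Rightarrow> rule set \<Rightarrow> rule set \<Rightarrow> (nat \<times> nat option) set \<Rightarrow> bool" where
  "terminal_ok C S Z E \<longleftrightarrow> (\<forall>r\<in>Z. ext_eqs r \<subseteq> E) \<and>
     (\<forall>r\<in>S. consistent (ext_eqs r \<union> E) \<longrightarrow> (\<exists>r'\<in>Z. covers C r r'))"

text \<open>Existence of a correct terminal label for the answers \<open>E\<close>: the best
  candidate is the set of all rules of \<open>S\<close> realized in \<open>E\<close>.\<close>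

definition decided :: "problem \<Rightarrow> rule set \<Rightarrow> (nat \<times> nat option) set \<Rightarrow> bool" where
  "decided C S E \<longleftrightarrow>
     (\<forall>r\<in>S. consistent (ext_eqs r \<union> E) \<longrightarrow> (\<exists>r'\<in>S. covers C r r' \<and> ext_eqs r' \<subseteq> E))"

text \<open>\<open>E\<close> may become inconsistent when an attribute is asked again; it is then
  \<open>decided\<close> vacuously, just as inconsistent paths carry no condition.\<close>

primrec solvable :: "problem \<Rightarrow> rule set \<Rightarrow> nat \<Rightarrow> (nat \<times> nat option) set \<Rightarrow> bool" where
  "solvable C S 0 E \<longleftrightarrow> decided C S E"
| "solvable C S (Suc m) E \<longleftrightarrow>
     decided C S E \<or> (\<exists>a\<in>attrs S. \<forall>\<delta>\<in>labels C S a. solvable C S m (insert (a, \<delta>) E))"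

abbreviation answers :: "(nat \<Rightarrow> nat option) \<Rightarrow> nat set \<Rightarrow> (nat \<times> nat option) set" where
  "answers f Q \<equiv> (\<lambda>a. (a, f a)) ` Q"

lemma covers_refl [simp]: "covers C r r"
  by (simp add: covers_def)

text \<open>Contraposition gives each correctness condition the same form: an unrefuted rule must be
  covered by the label. For AR this means membership, for SR a nonempty label.\<close>

lemma solves_iff:
  "solves C S \<Gamma> \<longleftrightarrow> tree_over (labels C S) S \<Gamma> \<and>
     (\<forall>\<xi> Z. complete_path \<Gamma> \<xi> Z \<and> consistent (set \<xi>) \<longrightarrow> terminal_ok C S Z (set \<xi>))"
proof -
  have AR: "AR_correct S \<Gamma> \<longleftrightarrow>
    (\<forall>\<xi> Z. complete_path \<Gamma> \<xi> Z \<and> consistent (set \<xi>) \<longrightarrow> terminal_ok C S Z (set \<xi>))"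
    if "C \<in> {AR, EAR}"
  proof -
    have "(\<forall>r\<in>S - Z. \<not> consistent (ext_eqs r \<union> E)) \<longleftrightarrow>
        (\<forall>r\<in>S. consistent (ext_eqs r \<union> E) \<longrightarrow> (\<exists>r'\<in>Z. covers C r r'))" for Z and E
      using that unfolding covers_def by auto
    then show ?thesis
      unfolding AR_correct_def terminal_ok_def by simp
  qed
  have AD: "AD_correct S \<Gamma> \<longleftrightarrow>
    (\<forall>\<xi> Z. complete_path \<Gamma> \<xi> Z \<and> consistent (set \<xi>) \<longrightarrow> terminal_ok C S Z (set \<xi>))"
    if "C \<in> {AD, EAD}"
  proof -
    have "(\<forall>r\<in>S - Z. rhs r \<notin> rhs ` Z \<longrightarrow> \<not> consistent (ext_eqs r \<union> E)) \<longleftrightarrow>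
        (\<forall>r\<in>S. consistent (ext_eqs r \<union> E) \<longrightarrow> (\<exists>r'\<in>Z. covers C r r'))" for Z and E
    proof -
      have "covers C r r' \<longleftrightarrow> rhs r' = rhs r" for r r'
        using that unfolding covers_def by auto
      then show ?thesis
        by (metis Diff_iff imageE imageI)
    qed
    then show ?thesis
      unfolding AD_correct_def terminal_ok_def by simp
  qed
  have SR: "SR_correct S \<Gamma> \<longleftrightarrow>
    (\<forall>\<xi> Z. complete_path \<Gamma> \<xi> Z \<and> consistent (set \<xi>) \<longrightarrow> terminal_ok C S Z (set \<xi>))"
    if "C \<in> {SR, ESR}"
  proof -
    have "(Z = {} \<longrightarrow> (\<forall>r\<in>S. \<not> consistent (ext_eqs r \<union> E))) \<longleftrightarrow>
        (\<forall>r\<in>S. consistent (ext_eqs r \<union> E) \<longrightarrow> (\<exists>r'\<in>Z. covers C r r'))" for Z and E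
      using that unfolding covers_def by auto
    then show ?thesis
      unfolding SR_correct_def terminal_ok_def by simp
  qed
  show ?thesis
    by (cases C) (simp_all add: AR AD SR labels_def o_tree_def e_tree_def)
qed

lemma decidedI:
  assumes "Z \<subseteq> S" and "terminal_ok C S Z E"
  shows "decided C S E"
  using assms unfolding decided_def terminal_ok_def by blast

section \<open>Finiteness of attributes, values and edge labels\<close>

lemma finite_eqs: "S \<in> rule_systems \<Longrightarrow> r \<in> S \<Longrightarrow> finite (eqs r)"
  by (simp add: rule_systems_def is_rule_def)

lemma consistent_eqs: "S \<in> rule_systems \<Longrightarrow> r \<in> S \<Longrightarrow> consistent (eqs r)"
  by (simp add: rule_systems_def is_rule_def)

lemma finite_attrs: "S \<in> rule_systems \<Longrightarrow> finite (attrs S)"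
  by (auto simp: attrs_def rule_systems_def is_rule_def)

lemma finite_vals:
  assumes "S \<in> rule_systems"
  shows "finite (vals S a)"
proof -
  have "finite (\<Union>r\<in>S. eqs r)"
    using assms by (auto simp: rule_systems_def is_rule_def)
  moreover have "vals S a \<subseteq> snd ` (\<Union>r\<in>S. eqs r)"
    by (force simp: vals_def)
  ultimately show ?thesis
    by (meson finite_imageI finite_subset)
qed

lemma vals_nonempty: "a \<in> attrs S \<Longrightarrow> vals S a \<noteq> {}"
  by (fastforce simp: attrs_def vals_def)

lemma finite_labels: "S \<in> rule_systems \<Longrightarrow> finite (labels C S a)"
  by (simp add: labels_def e_labels_def o_labels_def finite_vals)

lemma labels_nonempty: "a \<in> attrs S \<Longrightarrow> labels C S a \<noteq> {}"
  by (simp add: labels_def e_labels_def o_labels_def vals_nonempty)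

lemma Some_in_labels [simp]: "Some \<delta> \<in> labels C S a \<longleftrightarrow> \<delta> \<in> vals S a"
  by (auto simp: labels_def e_labels_def o_labels_def)

section \<open>Complete paths and depth of a tree\<close>

text \<open>Counting: there are as many distinct edge labels as elements of \<open>L a\<close>, so
  every possible answer has its branch.\<close>

lemma working_labels:
  assumes "finite (L a)" and "length es = card (L a)" and "distinct (map fst es)"
    and "fst ` set es \<subseteq> L a"
  shows "fst ` set es = L a"
proof -
  have "card (fst ` set es) = card (L a)"
    using assms(2) distinct_card[OF assms(3)] by simp
  then show ?thesis
    using assms(1,4) card_subset_eq by blast
qed

text \<open>Together with the existence of a path, this makes the \<open>Max\<close> in
  \<open>depth\<close> range over a finite nonempty set.\<close>

lemma finite_complete_paths: "finite {\<xi>. \<exists>Z. complete_path \<Gamma> \<xi> Z}"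
proof (induction \<Gamma>)
  case (Terminal Z)
  have "{\<xi>. \<exists>Z'. complete_path (Terminal Z) \<xi> Z'} \<subseteq> {[]}"
    by (auto elim: complete_path.cases)
  then show ?case
    using finite_subset by blast
next
  case (Working a es)
  have "{\<xi>. \<exists>Z. complete_path (Working a es) \<xi> Z} \<subseteq>
      (\<Union>e\<in>set es. (#) (a, fst e) ` {\<xi>. \<exists>Z. complete_path (snd e) \<xi> Z})"
  proof
    fix \<xi> assume "\<xi> \<in> {\<xi>. \<exists>Z. complete_path (Working a es) \<xi> Z}"
    then obtain Z where "complete_path (Working a es) \<xi> Z"
      by auto
    then obtain \<delta> \<Gamma> \<xi>' where "(\<delta>, \<Gamma>) \<in> set es" "complete_path \<Gamma> \<xi>' Z" "\<xi> = (a, \<delta>) # \<xi>'"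
      by cases auto
    then show "\<xi> \<in> (\<Union>e\<in>set es. (#) (a, fst e) ` {\<xi>. \<exists>Z. complete_path (snd e) \<xi> Z})"
      by (intro UN_I[of "(\<delta>, \<Gamma>)"]) auto
  qed
  moreover have "finite \<dots>"
    using Working by (intro finite_UN_I finite_imageI) (auto intro: snds.intros)
  ultimately show ?case
    using finite_subset by blast
qed

lemma ex_complete_path:
  assumes "S \<in> rule_systems" and "tree_over (labels C S) S \<Gamma>"
  shows "\<exists>\<xi> Z. complete_path \<Gamma> \<xi> Z"
  using assms(2)
proof (induction rule: tree_over.induct)
  case (terminal Z)
  then show ?case
    using complete_path.terminal by blast
next
  case (working a es)
  have "card (labels C S a) \<noteq> 0"
    using working(1) finite_labels[OF assms(1)] labels_nonempty by auto
  then obtain e where "e \<in> set es"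
    using working(2) by (cases es) auto
  then show ?case
    using working(5) complete_path.working[of "fst e" "snd e" es] by (metis prod.collapse)
qed

lemma depth_le_iff:
  assumes "S \<in> rule_systems" and "tree_over (labels C S) S \<Gamma>"
  shows "depth \<Gamma> \<le> m \<longleftrightarrow> (\<forall>\<xi> Z. complete_path \<Gamma> \<xi> Z \<longrightarrow> length \<xi> \<le> m)"
proof -
  have "{length \<xi> | \<xi> Z. complete_path \<Gamma> \<xi> Z} = length ` {\<xi>. \<exists>Z. complete_path \<Gamma> \<xi> Z}"
    by auto
  moreover have "{\<xi>. \<exists>Z. complete_path \<Gamma> \<xi> Z} \<noteq> {}"
    using ex_complete_path[OF assms] by auto
  ultimately show ?thesis
    using finite_complete_paths[of \<Gamma>] unfolding depth_def by auto
qed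

lemma complete_path_terminal_label:
  assumes "complete_path \<Gamma> \<xi> Z" and "tree_over L S \<Gamma>"
  shows "Z \<subseteq> S"
  using assms
  by (induction rule: complete_path.induct) (erule tree_over.cases; fastforce)+

section \<open>Equivalence of trees and strategies\<close>

lemma decided_imp_solvable: "decided C S E \<Longrightarrow> solvable C S m E"
  by (cases m) simp_all

lemma solvable_mono: "solvable C S m E \<Longrightarrow> m \<le> m' \<Longrightarrow> solvable C S m' E"
proof (induction m arbitrary: m' E)
  case 0
  then show ?case
    by (simp add: decided_imp_solvable)
next
  case (Suc m)
  then obtain m'' where "m' = Suc m''" "m \<le> m''"
    by (cases m') auto
  then show ?case
    using Suc by (simp add: Bex_def) blast
qed

text \<open>\<open>E\<close> stands for the answers on the way down to the subtree, so that the
  induction can descend edge by edge.\<close>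

lemma tree_imp_solvable:
  assumes "S \<in> rule_systems" and "tree_over (labels C S) S \<Gamma>"
    and "\<And>\<xi> Z. complete_path \<Gamma> \<xi> Z \<Longrightarrow> length \<xi> \<le> m \<and> decided C S (E \<union> set \<xi>)"
  shows "solvable C S m E"
  using assms(2,3)
proof (induction arbitrary: m E rule: tree_over.induct)
  case (terminal Z)
  have "decided C S E"
    using terminal(2)[OF complete_path.terminal] by simp
  then show ?case
    by (rule decided_imp_solvable)
next
  case (working a es)
  have eq: "fst ` set es = labels C S a"
    using working_labels[where L = "labels C S"] finite_labels[OF assms(1)] working(2,3,4) by blast
  \<comment> \<open>A path through this working node has at least one query, so \<open>m\<close> is
    a successor and one query can be charged to the node.\<close>
  have "tree_over (labels C S) S (Working a es)"
    using working(1-5) by (intro tree_over.working) auto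
  then obtain \<xi>0 Z0 where p0: "complete_path (Working a es) \<xi>0 Z0"
    using ex_complete_path[OF assms(1)] by blast
  have "length \<xi>0 \<noteq> 0"
    using p0 by (auto elim: complete_path.cases)
  then obtain m' where m: "m = Suc m'"
    using working(6)[OF p0] by (cases m) auto
  have "solvable C S m' (insert (a, \<delta>) E)" if \<delta>: "\<delta> \<in> labels C S a" for \<delta>
  proof -
    obtain \<Gamma> where e: "(\<delta>, \<Gamma>) \<in> set es"
      using \<delta> eq by force
    have "length \<xi> \<le> m' \<and> decided C S (insert (a, \<delta>) E \<union> set \<xi>)"
      if "complete_path \<Gamma> \<xi> Z" for \<xi> Z
      using working(6)[OF complete_path.working[OF e that]] m by simp
    then show ?thesis
      using working(5) e by force
  qed
  then show ?case
    using working(1) m by auto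
qed

text \<open>The tree copies the strategy, with one branch per label, and stops with the set of all
  realized rules as soon as \<open>E\<close> is decided.\<close>

lemma solvable_imp_tree:
  assumes "S \<in> rule_systems" and "solvable C S m E"
  shows "\<exists>\<Gamma>. tree_over (labels C S) S \<Gamma> \<and>
    (\<forall>\<xi> Z. complete_path \<Gamma> \<xi> Z \<longrightarrow> length \<xi> \<le> m \<and> terminal_ok C S Z (E \<union> set \<xi>))"
  using assms(2)
proof (induction m arbitrary: E)
  case 0
  then have "terminal_ok C S {r \<in> S. ext_eqs r \<subseteq> E} E"
    unfolding terminal_ok_def decided_def solvable.simps by blast
  then show ?case
    by (intro exI[of _ "Terminal {r \<in> S. ext_eqs r \<subseteq> E}"])
      (auto intro: tree_over.terminal elim: complete_path.cases)
next
  case (Suc m)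
  show ?case
  proof (cases "decided C S E")
    case True
    then have "terminal_ok C S {r \<in> S. ext_eqs r \<subseteq> E} E"
      unfolding terminal_ok_def decided_def by blast
    then show ?thesis
      by (intro exI[of _ "Terminal {r \<in> S. ext_eqs r \<subseteq> E}"])
        (auto intro: tree_over.terminal elim: complete_path.cases)
  next
    case False
    then obtain a where a: "a \<in> attrs S"
      and sub: "\<forall>\<delta>\<in>labels C S a. solvable C S m (insert (a, \<delta>) E)"
      using Suc.prems by auto
    have "\<forall>\<delta>\<in>labels C S a. \<exists>\<Gamma>. tree_over (labels C S) S \<Gamma> \<and>
      (\<forall>\<xi> Z. complete_path \<Gamma> \<xi> Z \<longrightarrow>
        length \<xi> \<le> m \<and> terminal_ok C S Z (insert (a, \<delta>) E \<union> set \<xi>))"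
      using sub Suc.IH by blast
    then obtain F where F: "\<And>\<delta>. \<delta> \<in> labels C S a \<Longrightarrow> tree_over (labels C S) S (F \<delta>)"
      "\<And>\<delta> \<xi> Z. \<delta> \<in> labels C S a \<Longrightarrow> complete_path (F \<delta>) \<xi> Z \<Longrightarrow>
        length \<xi> \<le> m \<and> terminal_ok C S Z (insert (a, \<delta>) E \<union> set \<xi>)"
      by metis
    obtain xs where xs: "set xs = labels C S a" "distinct xs"
      using finite_distinct_list[OF finite_labels[OF assms(1)]] by blast
    define es where "es = map (\<lambda>\<delta>. (\<delta>, F \<delta>)) xs"
    have fst_es: "map fst es = xs"
      by (simp add: es_def comp_def)
    have "tree_over (labels C S) S (Working a es)"
    proof (rule tree_over.working)
      show "length es = card (labels C S a)"
        using xs distinct_card[of xs] by (simp add: es_def)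
      show "fst ` set es \<subseteq> labels C S a"
        using xs fst_es by (metis list.set_map order_refl)
    qed (use a xs fst_es F in \<open>auto simp: es_def\<close>)
    moreover have "length \<xi> \<le> Suc m \<and> terminal_ok C S Z (E \<union> set \<xi>)"
      if "complete_path (Working a es) \<xi> Z" for \<xi> Z
      using that
    proof cases
      case (working \<delta> \<Gamma> \<xi>')
      then have "\<delta> \<in> labels C S a" "\<Gamma> = F \<delta>"
        using xs by (auto simp: es_def)
      then show ?thesis
        using F(2)[of \<delta> \<xi>' Z] working by simp
    qed
    ultimately show ?thesis
      by blast
  qed
qed

section \<open>Answer functions and batches of queries\<close>

lemma consistent_answers [simp]: "consistent (answers f Q)"
  by (auto simp: single_valued_def)

lemma not_consistentI:
  assumes "(a, \<delta>) \<in> eqs r" and "(a, x) \<in> E" and "x \<noteq> Some \<delta>"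
  shows "\<not> consistent (ext_eqs r \<union> E)"
  using assms unfolding single_valued_def ext_eqs_def by blast

lemma not_consistent_answersD:
  assumes "consistent (eqs r)" and "\<not> consistent (ext_eqs r \<union> answers f Q)"
  obtains a \<delta> where "(a, \<delta>) \<in> eqs r" "a \<in> Q" "f a \<noteq> Some \<delta>"
  using assms unfolding single_valued_def ext_eqs_def by auto

lemma ext_eqs_subset_answersD:
  assumes "ext_eqs r \<subseteq> answers f Q" and "(a, \<delta>) \<in> eqs r"
  shows "a \<in> Q" and "f a = Some \<delta>"
  using assms by (force simp: ext_eqs_def)+

lemma eqs_attrs: "r \<in> S \<Longrightarrow> (a, \<delta>) \<in> eqs r \<Longrightarrow> a \<in> attrs S"
  by (force simp: attrs_def)

lemma eqs_vals: "r \<in> S \<Longrightarrow> (a, \<delta>) \<in> eqs r \<Longrightarrow> \<delta> \<in> vals S a"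
  by (auto simp: vals_def)

text \<open>The attributes of \<open>B\<close> are asked one after the other whatever the answers;
  \<open>f\<close> ranges over the possible answer vectors.\<close>

lemma solvable_query:
  assumes "finite B" and "B \<subseteq> attrs S"
    and "\<And>f. (\<And>b. b \<in> B \<Longrightarrow> f b \<in> labels C S b) \<Longrightarrow> solvable C S m (E \<union> answers f B)"
  shows "solvable C S (card B + m) E"
  using assms
proof (induction arbitrary: E rule: finite_induct)
  case empty
  then show ?case
    by simp
next
  case (insert a B)
  have "solvable C S (card B + m) (insert (a, \<delta>) E)" if \<delta>: "\<delta> \<in> labels C S a" for \<delta>
  proof (rule insert.IH)
    show "B \<subseteq> attrs S"
      using insert.prems by simp
    fix f assume f: "\<And>b. b \<in> B \<Longrightarrow> f b \<in> labels C S b"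
    have "solvable C S m (E \<union> answers (f(a := \<delta>)) (insert a B))"
      by (rule insert.prems(2)) (use f \<delta> in auto)
    moreover have "answers (f(a := \<delta>)) B = answers f B"
      using insert.hyps by (auto simp: image_iff)
    ultimately show "solvable C S m (insert (a, \<delta>) E \<union> answers f B)"
      by simp
  qed
  then show ?case
    using insert.prems(1) insert.hyps by (simp add: bexI[of _ a])
qed

lemma ext_eqs_subsetI:
  assumes "consistent (ext_eqs r \<union> E)" and "\<And>a \<delta>. (a, \<delta>) \<in> eqs r \<Longrightarrow> a \<in> fst ` E"
  shows "ext_eqs r \<subseteq> E"
proof
  fix e assume "e \<in> ext_eqs r"
  then obtain a \<delta> where e: "e = (a, Some \<delta>)" "(a, \<delta>) \<in> eqs r"
    by (auto simp: ext_eqs_def)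
  then obtain x where "(a, x) \<in> E"
    using assms(2) by force
  then show "e \<in> E"
    using not_consistentI assms(1) e by metis
qed

lemma decided_by_all_attrs: "decided C S (answers f (attrs S))"
  unfolding decided_def
proof (intro ballI impI)
  fix r assume r: "r \<in> S" "consistent (ext_eqs r \<union> answers f (attrs S))"
  have "ext_eqs r \<subseteq> answers f (attrs S)"
    using r eqs_attrs by (intro ext_eqs_subsetI) (auto simp: image_image)
  then show "\<exists>r'\<in>S. covers C r r' \<and> ext_eqs r' \<subseteq> answers f (attrs S)"
    using r covers_refl by blast
qed

lemma solvable_n_of:
  assumes "S \<in> rule_systems"
  shows "solvable C S (n_of S) {}"
proof -
  have "solvable C S (card (attrs S) + 0) {}"
    using finite_attrs[OF assms] decided_by_all_attrs by (intro solvable_query) auto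
  then show ?thesis
    by (simp add: n_of_def)
qed

text \<open>Translates depth into \<open>solvable\<close>, in which the bounds are proved. Asking
  all attributes yields a solving tree, so the \<open>LEAST\<close> in \<open>h\<close> is
  attained.\<close>

lemma h_le_iff:
  assumes "S \<in> rule_systems" and "n_of S > 0"
  shows "h C S \<le> m \<longleftrightarrow> solvable C S m {}"
proof -
  have tree: "\<exists>\<Gamma>. solves C S \<Gamma> \<and> depth \<Gamma> \<le> m" if solv: "solvable C S m {}" for m
  proof -
    obtain \<Gamma> where "tree_over (labels C S) S \<Gamma>"
      "\<forall>\<xi> Z. complete_path \<Gamma> \<xi> Z \<longrightarrow> length \<xi> \<le> m \<and> terminal_ok C S Z (set \<xi>)"
      using solvable_imp_tree[OF assms(1) solv] by auto
    then show ?thesis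
      using depth_le_iff[OF assms(1)] unfolding solves_iff by blast
  qed
  have h: "h C S = (LEAST m. \<exists>\<Gamma>. solves C S \<Gamma> \<and> depth \<Gamma> = m)"
    using assms(2) by (simp add: h_def)
  show ?thesis
  proof
    assume le: "h C S \<le> m"
    have "\<exists>m \<Gamma>. solves C S \<Gamma> \<and> depth \<Gamma> = m"
      using tree[OF solvable_n_of[OF assms(1)]] by blast
    then have "\<exists>\<Gamma>. solves C S \<Gamma> \<and> depth \<Gamma> = h C S"
      unfolding h by (rule LeastI_ex)
    then obtain \<Gamma> where \<Gamma>: "solves C S \<Gamma>" "depth \<Gamma> \<le> m"
      using le by auto
    have t: "tree_over (labels C S) S \<Gamma>"
      using \<Gamma>(1) by (simp add: solves_iff)
    show "solvable C S m {}"
    proof (rule tree_imp_solvable[OF assms(1) t])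
      fix \<xi> Z assume p: "complete_path \<Gamma> \<xi> Z"
      have "decided C S (set \<xi>)"
      proof (cases "consistent (set \<xi>)")
        case True
        then show ?thesis
          using \<Gamma>(1) p complete_path_terminal_label[OF p t] decidedI unfolding solves_iff by blast
      next
        \<comment> \<open>An inconsistent path stays inconsistent after adding any rule, so
          \<open>decided\<close> holds vacuously.\<close>
        case False
        then show ?thesis
          unfolding decided_def using single_valued_subset by (metis Un_upper2)
      qed
      then show "length \<xi> \<le> m \<and> decided C S ({} \<union> set \<xi>)"
        using p \<Gamma>(2) depth_le_iff[OF assms(1) t] by auto
    qed
  next
    assume "solvable C S m {}"
    then obtain \<Gamma> where \<Gamma>: "solves C S \<Gamma>" "depth \<Gamma> \<le> m"
      using tree by blast
    have "h C S \<le> depth \<Gamma>"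
      unfolding h by (rule Least_le) (use \<Gamma> in blast)
    then show "h C S \<le> m"
      using \<Gamma> by simp
  qed
qed

text \<open>Following the branch labeled \<open>f a\<close> at every query gives a play;
  \<open>Q\<close> collects the attributes it asks.\<close>

lemma solvable_answers:
  assumes "solvable C S m E" and "\<And>a. a \<in> attrs S \<Longrightarrow> f a \<in> labels C S a"
  obtains Q where "finite Q" "Q \<subseteq> attrs S" "card Q \<le> m" "decided C S (E \<union> answers f Q)"
  using assms(1)
proof (induction m arbitrary: E thesis)
  case 0
  then show ?case
    by (intro 0(1)[of "{}"]) auto
next
  case (Suc m)
  show ?case
  proof (cases "decided C S E")
    case True
    then show ?thesis
      by (intro Suc.prems(1)[of "{}"]) auto
  next
    case False
    then obtain a where a: "a \<in> attrs S" "solvable C S m (insert (a, f a) E)"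
      using Suc.prems(2) assms(2) by auto
    then obtain Q where "finite Q" "Q \<subseteq> attrs S" "card Q \<le> m"
      "decided C S (insert (a, f a) E \<union> answers f Q)"
      using Suc.IH by blast
    then show ?thesis
      using a card_insert_le_m1[of "Suc m" Q a]
      by (intro Suc.prems(1)[of "insert a Q"]) auto
  qed
qed

lemma h_answers:
  assumes "S \<in> rule_systems" and "n_of S > 0" and "\<And>a. a \<in> attrs S \<Longrightarrow> f a \<in> labels C S a"
  obtains Q where "finite Q" "Q \<subseteq> attrs S" "card Q \<le> h C S" "decided C S (answers f Q)"
  using solvable_answers[of C S "h C S" "{}" f] h_le_iff[OF assms(1,2), of C "h C S"] assms(3)
  by auto

lemma h_le_n_of: "S \<in> rule_systems \<Longrightarrow> n_of S > 0 \<Longrightarrow> h C S \<le> n_of S"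
  by (simp add: h_le_iff solvable_n_of)

text \<open>Dropping the answer \<open>*\<close> only removes plays, and \<open>decided\<close> is
  the same for both problems.\<close>

lemma solvable_AR_EAR: "solvable EAR S m E \<Longrightarrow> solvable AR S m E"
proof (induction m arbitrary: E)
  case 0
  then show ?case
    by (simp add: decided_def covers_def)
next
  case (Suc m)
  have "decided EAR S E \<Longrightarrow> decided AR S E"
    by (simp add: decided_def covers_def)
  moreover have "labels AR S a \<subseteq> labels EAR S a" for a
    by (auto simp: labels_def o_labels_def e_labels_def)
  ultimately show ?case
    using Suc.IH Suc.prems unfolding solvable.simps by (meson subsetD)
qed

lemma h_AR_le_h_EAR:
  assumes "S \<in> rule_systems" and "n_of S > 0"
  shows "h AR S \<le> h EAR S"
  using h_le_iff[OF assms] solvable_AR_EAR by blast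

section \<open>Lower bounds\<close>

lemma consistent_imp_partial_function:
  fixes E :: "('a \<times> 'b) set"
  assumes "consistent E"
  obtains f where "\<And>a \<delta>. f a = Some \<delta> \<longleftrightarrow> (a, \<delta>) \<in> E"
proof -
  have "\<exists>x. \<forall>\<delta>. x = Some \<delta> \<longleftrightarrow> (a, \<delta>) \<in> E" for a
    using assms unfolding single_valued_def by (cases "\<exists>\<delta>. (a, \<delta>) \<in> E") (metis option.inject, metis option.distinct(1))
  then show ?thesis
    using that by metis
qed

text \<open>As \<open>eqs r\<close> is single-valued, a conflict can only arise between an equation
  of \<open>r\<close> and an answer.\<close>

lemma decided_answers_cases:
  assumes "S \<in> rule_systems" and "decided C S (answers f Q)" and "r \<in> S"
  obtains (covered) r' where "r' \<in> S" "covers C r r'" "ext_eqs r' \<subseteq> answers f Q"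
  | (refuted) a \<delta> where "(a, \<delta>) \<in> eqs r" "a \<in> Q" "f a \<noteq> Some \<delta>"
  using assms not_consistent_answersD[OF consistent_eqs[OF assms(1,3)]]
  unfolding decided_def by metis

lemma card_eqs_le_d_of: "S \<in> rule_systems \<Longrightarrow> r \<in> S \<Longrightarrow> card (eqs r) \<le> d_of S"
  by (auto simp: d_of_def rule_systems_def)

lemma d_of_attained:
  assumes "S \<in> rule_systems"
  obtains r where "r \<in> S" "card (eqs r) = d_of S"
proof -
  have "d_of S \<in> (\<lambda>r. card (eqs r)) ` S"
    unfolding d_of_def using assms by (intro Max_in) (auto simp: rule_systems_def)
  then show ?thesis
    using that by auto
qed

lemma card_vals_le_k_of:
  assumes "S \<in> rule_systems"
  shows "card (vals S a) \<le> k_of S"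
proof (cases "a \<in> attrs S")
  case True
  then have "n_of S > 0"
    using finite_attrs[OF assms] by (auto simp: n_of_def card_gt_0_iff)
  then show ?thesis
    using True finite_attrs[OF assms] by (auto simp: k_of_def)
next
  case False
  then have "vals S a = {}"
    by (force simp: vals_def attrs_def)
  then show ?thesis
    by simp
qed

lemma card_fst_eqs:
  assumes "S \<in> rule_systems" and "r \<in> S"
  shows "card (fst ` eqs r) = card (eqs r)"
  using consistent_eqs[OF assms] by (intro card_image inj_onI) (auto simp: single_valued_def)

text \<open>Answers satisfying \<open>r\<close> cannot refute it, so a realized rule covers it; by
  \<open>uniq\<close> that rule has the equations of \<open>r\<close>, all of whose attributes were
  therefore queried.\<close>

lemma card_eqs_le_h:
  assumes S: "S \<in> rule_systems" "n_of S > 0" and r: "r \<in> S"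
    and f: "\<And>a. a \<in> attrs S \<Longrightarrow> f a \<in> labels C S a" "\<And>a \<delta>. (a, \<delta>) \<in> eqs r \<Longrightarrow> f a = Some \<delta>"
    and uniq: "\<And>r'. r' \<in> S \<Longrightarrow> covers C r r' \<Longrightarrow> \<forall>(a, \<delta>)\<in>eqs r'. f a = Some \<delta> \<Longrightarrow> eqs r' = eqs r"
  shows "card (eqs r) \<le> h C S"
proof -
  obtain Q where Q: "finite Q" "card Q \<le> h C S" "decided C S (answers f Q)"
    using h_answers[OF S f(1)] by metis
  from S(1) Q(3) r show ?thesis
  proof (cases rule: decided_answers_cases)
    case (covered r')
    then have "eqs r' = eqs r"
      using ext_eqs_subset_answersD by (intro uniq) blast+
    then have "fst ` eqs r \<subseteq> Q"
      using ext_eqs_subset_answersD(1)[OF covered(3)] by auto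
    then show ?thesis
      using card_mono[OF Q(1), of "fst ` eqs r"] Q(2) card_fst_eqs[OF S(1) r] by simp
  next
    case refuted
    then show ?thesis
      using f(2) by auto
  qed
qed

text \<open>Fixing the coordinates in \<open>B\<close> replaces \<open>card B\<close> factors, each
  of size at most \<open>k\<close>, by singletons.\<close>

lemma card_PiE_restrict:
  fixes V :: "'a \<Rightarrow> 'b set"
  assumes "finite A" and "\<And>a. a \<in> A \<Longrightarrow> finite (V a) \<and> card (V a) \<le> k" and "B \<subseteq> A"
    and "\<And>b. b \<in> B \<Longrightarrow> g b \<in> V b"
  shows "card (PiE A V) \<le> k ^ card B * card {f \<in> PiE A V. \<forall>b\<in>B. f b = g b}"
proof -
  let ?W = "\<lambda>a. if a \<in> B then {g a} else V a"
  have fin: "finite B"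
    using assms(1,3) finite_subset by blast
  have eq: "{f \<in> PiE A V. \<forall>b\<in>B. f b = g b} = PiE A ?W"
    using assms(3,4) by (auto simp: PiE_iff extensional_def split: if_splits)
  have A: "A = B \<union> (A - B)"
    using assms(3) by blast
  have "(\<Prod>a\<in>B. card (V a)) \<le> (\<Prod>a\<in>B. k)"
    using assms(2,3) by (intro prod_mono) auto
  then have B: "(\<Prod>a\<in>B. card (V a)) \<le> k ^ card B"
    by simp
  have "card (PiE A V) = (\<Prod>a\<in>B. card (V a)) * (\<Prod>a\<in>A - B. card (V a))"
    using assms(1,3) by (simp add: card_PiE prod.subset_diff mult.commute)
  moreover have "card (PiE A ?W) = (\<Prod>a\<in>A - B. card (V a))"
    using assms(1,3) by (simp add: card_PiE prod.subset_diff)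
  ultimately show ?thesis
    using B eq by simp
qed

text \<open>For a uniformly random assignment, an attribute \<open>a\<close> of a rule \<open>r\<close> has to be queried as soon as all
  equations of \<open>r\<close> at other attributes hold, which has probability at least \<open>1 / k ^ (d - 1)\<close>.\<close>

lemma n_of_le_h_AR:
  assumes S: "S \<in> rule_systems" "n_of S > 0" and C: "C \<in> {AR, EAR}"
  shows "n_of S \<le> h C S * k_of S ^ (d_of S - 1)"
proof -
  define P where "P = PiE (attrs S) (vals S)"
  have fin: "finite P"
    unfolding P_def using finite_attrs[OF S(1)] finite_vals[OF S(1)] by (intro finite_PiE) auto
  have P0: "card P > 0"
    unfolding P_def using finite_attrs[OF S(1)] finite_vals[OF S(1)] vals_nonempty[of _ S]
    by (auto simp: card_PiE card_gt_0_iff intro!: prod_pos)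
  have "\<forall>g\<in>P. \<exists>Q. finite Q \<and> card Q \<le> h C S \<and> decided C S (answers (Some \<circ> g) Q)"
  proof
    fix g assume g: "g \<in> P"
    have "(Some \<circ> g) a \<in> labels C S a" if "a \<in> attrs S" for a
      using g that by (auto simp: P_def PiE_iff)
    then show "\<exists>Q. finite Q \<and> card Q \<le> h C S \<and> decided C S (answers (Some \<circ> g) Q)"
      using h_answers[OF S, of "Some \<circ> g" C] by metis
  qed
  then obtain Q where Q: "\<And>g. g \<in> P \<Longrightarrow> finite (Q g)" "\<And>g. g \<in> P \<Longrightarrow> card (Q g) \<le> h C S"
    "\<And>g. g \<in> P \<Longrightarrow> decided C S (answers (Some \<circ> g) (Q g))"
    by metis
  have each: "card P \<le> k_of S ^ (d_of S - 1) * card {g \<in> P. a \<in> Q g}" if a: "a \<in> attrs S" for a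
  proof -
    obtain r \<delta> where r: "r \<in> S" "(a, \<delta>) \<in> eqs r"
      using a by (auto simp: attrs_def)
    define B where "B = fst ` eqs r - {a}"
    obtain w where w: "\<And>b \<delta>. w b = Some \<delta> \<longleftrightarrow> (b, \<delta>) \<in> eqs r"
      using consistent_imp_partial_function[OF consistent_eqs[OF S(1) r(1)]] by blast
    define v where "v b = the (w b)" for b
    have v: "v b = \<delta>" if "(b, \<delta>) \<in> eqs r" for b \<delta>
      using that w[of b \<delta>] by (simp add: v_def)
    have B: "B \<subseteq> attrs S" "\<And>b. b \<in> B \<Longrightarrow> v b \<in> vals S b"
      using r(1) v eqs_attrs eqs_vals unfolding B_def by fastforce+
    have "a \<in> fst ` eqs r"
      using r(2) by force
    then have "card B = card (eqs r) - 1"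
      unfolding B_def using card_fst_eqs[OF S(1) r(1)] by (simp add: card_Diff_singleton)
    then have cB: "card B \<le> d_of S - 1"
      using card_eqs_le_d_of[OF S(1) r(1)] by simp
    \<comment> \<open>If every other equation of \<open>r\<close> holds, only \<open>a\<close> can
      refute \<open>r\<close>; if \<open>r\<close> is realized instead, \<open>a\<close> was asked
      as well.\<close>
    have sub: "{g \<in> P. \<forall>b\<in>B. g b = v b} \<subseteq> {g \<in> P. a \<in> Q g}"
    proof clarify
      fix g assume g: "g \<in> P" "\<forall>b\<in>B. g b = v b"
      from S(1) Q(3)[OF g(1)] r(1) show "a \<in> Q g"
      proof (cases rule: decided_answers_cases)
        case (covered r')
        then have "r' = r"
          using C by (auto simp: covers_def)
        then show ?thesis
          using ext_eqs_subset_answersD(1)[OF covered(3)] r(2) by blast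
      next
        case (refuted b \<epsilon>)
        then have "b = a"
          using g(2) v unfolding B_def by force
        then show ?thesis
          using refuted by simp
      qed
    qed
    have "0 < card (vals S a)"
      using finite_vals[OF S(1)] vals_nonempty[OF a] by (simp add: card_gt_0_iff)
    then have k0: "k_of S > 0"
      using card_vals_le_k_of[OF S(1)] by (meson le_less_trans not_le)
    have "card P \<le> k_of S ^ card B * card {g \<in> P. \<forall>b\<in>B. g b = v b}"
      unfolding P_def using finite_attrs[OF S(1)] finite_vals[OF S(1)] card_vals_le_k_of[OF S(1)] B
      by (intro card_PiE_restrict) auto
    also have "\<dots> \<le> k_of S ^ (d_of S - 1) * card {g \<in> P. a \<in> Q g}"
      using cB k0 sub fin by (intro mult_mono power_increasing card_mono) auto
    finally show ?thesis .
  qed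
  have "card P * n_of S = (\<Sum>a\<in>attrs S. card P)"
    by (simp add: n_of_def)
  also have "\<dots> \<le> (\<Sum>a\<in>attrs S. k_of S ^ (d_of S - 1) * card {g \<in> P. a \<in> Q g})"
    using each by (rule sum_mono)
  also have "\<dots> = k_of S ^ (d_of S - 1) * (\<Sum>a\<in>attrs S. card {g \<in> P. a \<in> Q g})"
    by (simp add: sum_distrib_left)
  \<comment> \<open>Double counting of the pairs of an attribute and an assignment under which it is
    queried.\<close>
  also have "(\<Sum>a\<in>attrs S. card {g \<in> P. a \<in> Q g}) = (\<Sum>g\<in>P. card {a \<in> attrs S. a \<in> Q g})"
    using sum.swap_restrict[OF finite_attrs[OF S(1)] fin, of "\<lambda>_ _. 1::nat" "\<lambda>a g. a \<in> Q g"] by simp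
  also have "\<dots> \<le> (\<Sum>g\<in>P. h C S)"
  proof (rule sum_mono)
    fix g assume g: "g \<in> P"
    have "card {a \<in> attrs S. a \<in> Q g} \<le> card (Q g)"
      using Q(1)[OF g] by (intro card_mono) auto
    then show "card {a \<in> attrs S. a \<in> Q g} \<le> h C S"
      using Q(2)[OF g] by simp
  qed
  finally have "card P * n_of S \<le> card P * (h C S * k_of S ^ (d_of S - 1))"
    by (simp add: algebra_simps)
  then show ?thesis
    using P0 by simp
qed

section \<open>Reduced systems and rules of maximal length\<close>

text \<open>Expresses SR- and AD-reducedness at once: \<open>covers\<close> is always true for the
  former and compares right-hand sides for the latter.\<close>

definition minimal_rules :: "problem \<Rightarrow> rule set \<Rightarrow> bool" where
  "minimal_rules C S \<longleftrightarrow> (\<forall>r\<in>S. \<forall>r'\<in>S. covers C r r' \<longrightarrow> \<not> eqs r' \<subset> eqs r)"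

lemma reduced_for_iff:
  assumes "C \<in> {SR, ESR, AD, EAD}"
  shows "reduced_for C S \<longleftrightarrow> minimal_rules C S"
proof -
  have "{r \<in> S. P r} = S \<longleftrightarrow> (\<forall>r\<in>S. P r)" for P
    by blast
  then show ?thesis
    using assms
    by (elim insertE) (simp_all add: minimal_rules_def SR_reduced_def AD_reduced_def covers_def)
qed

text \<open>The answers are the equations of a longest rule and \<open>*\<close> elsewhere. A
  realized covering rule then lies inside it, and minimality makes it equal. For
  \<open>d_of S = n_of S\<close> that rule mentions every attribute, so \<open>*\<close> never
  occurs and o-trees are included.\<close>

lemma d_of_le_h:
  assumes S: "S \<in> rule_systems" "n_of S > 0" and min: "minimal_rules C S"
    and C: "C \<in> {ESR, EAD} \<or> d_of S = n_of S"
  shows "d_of S \<le> h C S"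
proof -
  obtain r where r: "r \<in> S" "card (eqs r) = d_of S"
    using d_of_attained[OF S(1)] .
  obtain f where f: "\<And>a \<delta>. f a = Some \<delta> \<longleftrightarrow> (a, \<delta>) \<in> eqs r"
    using consistent_imp_partial_function[OF consistent_eqs[OF S(1) r(1)]] by blast
  have eq: "fst ` eqs r = attrs S" if "d_of S = n_of S"
    using that r card_fst_eqs[OF S(1) r(1)] finite_attrs[OF S(1)] eqs_attrs[OF r(1)]
    by (intro card_subset_eq) (auto simp: n_of_def)
  have lab: "f a \<in> labels C S a" if "a \<in> attrs S" for a
  proof (cases "f a")
    case None
    then have "a \<notin> fst ` eqs r"
      using f by force
    then show ?thesis
      using None C that eq by (auto simp: labels_def e_labels_def)
  next
    case (Some \<delta>)
    then show ?thesis
      using f eqs_vals[OF r(1)] by (metis Some_in_labels)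
  qed
  have "card (eqs r) \<le> h C S"
  proof (rule card_eqs_le_h[OF S r(1), of f])
    fix r' assume r': "r' \<in> S" "covers C r r'" "\<forall>(a, \<delta>)\<in>eqs r'. f a = Some \<delta>"
    then have "eqs r' \<subseteq> eqs r"
      using f by auto
    then show "eqs r' = eqs r"
      using min r' r(1) unfolding minimal_rules_def by auto
  qed (use f lab in auto)
  then show ?thesis
    using r by simp
qed

text \<open>Only \<open>r\<close> itself covers \<open>r\<close> here, so the answers off
  \<open>r\<close> may be any occurring values, which are legal in o-trees as well.\<close>

lemma d_of_le_h_AR:
  assumes S: "S \<in> rule_systems" "n_of S > 0" and C: "C \<in> {AR, EAR}"
  shows "d_of S \<le> h C S"
proof -
  obtain r where r: "r \<in> S" "card (eqs r) = d_of S"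
    using d_of_attained[OF S(1)] .
  obtain g where g: "\<And>a \<delta>. g a = Some \<delta> \<longleftrightarrow> (a, \<delta>) \<in> eqs r"
    using consistent_imp_partial_function[OF consistent_eqs[OF S(1) r(1)]] by blast
  define f where "f a = (if g a = None then Some (SOME \<delta>. \<delta> \<in> vals S a) else g a)" for a
  have f: "f a = Some \<delta>" if "(a, \<delta>) \<in> eqs r" for a \<delta>
    using that g[of a \<delta>] by (simp add: f_def)
  have lab: "f a \<in> labels C S a" if "a \<in> attrs S" for a
  proof (cases "g a")
    case None
    then show ?thesis
      using vals_nonempty[OF that] by (simp add: f_def some_in_eq)
  next
    case (Some \<delta>)
    then show ?thesis
      using g[of a \<delta>] eqs_vals[OF r(1)] by (simp add: f_def)
  qed
  have "card (eqs r) \<le> h C S"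
    by (rule card_eqs_le_h[OF S r(1), of f]) (use f lab C in \<open>auto simp: covers_def\<close>)
  then show ?thesis
    using r by simp
qed

text \<open>Without a query only a rule without equations is realized, and minimality forbids it to
  cover a nonempty rule.\<close>

lemma h_pos:
  assumes S: "S \<in> rule_systems" "n_of S > 0" and min: "minimal_rules C S"
  shows "h C S > 0"
proof (rule ccontr)
  assume "\<not> ?thesis"
  then have dec: "decided C S {}"
    using h_le_iff[OF S, of C 0] by simp
  obtain a r \<delta> where r: "r \<in> S" "(a, \<delta>) \<in> eqs r"
    using S(2) by (fastforce simp: n_of_def card_gt_0_iff attrs_def)
  have "consistent (ext_eqs r)"
    using consistent_eqs[OF S(1) r(1)] by (auto simp: ext_eqs_def single_valued_def)
  then obtain r' where r': "r' \<in> S" "covers C r r'" "ext_eqs r' \<subseteq> {}"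
    using dec r(1) unfolding decided_def by auto
  then have "eqs r' = {}"
    by (auto simp: ext_eqs_def)
  then show False
    using r r' min unfolding minimal_rules_def by blast
qed

section \<open>Branching argument for trees with \<open>*\<close>-edges\<close>

text \<open>\<open>Q E\<close> is going to be the set of attributes queried when the answers follow
  \<open>E\<close>. Level \<open>j\<close> holds the sets obtained by guessing \<open>j\<close>
  times a queried attribute and a value for it.\<close>

primrec branches :: "((nat \<times> nat) set \<Rightarrow> nat set) \<Rightarrow> (nat \<Rightarrow> nat set) \<Rightarrow> nat \<Rightarrow> (nat \<times> nat) set set" where
  "branches Q V 0 = {{}}"
| "branches Q V (Suc j) = (\<Union>E\<in>branches Q V j. \<Union>a\<in>Q E. \<Union>\<delta>\<in>V a. {insert (a, \<delta>) E})"

lemma card_UN_le_mult: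
  assumes "finite I" and "card I \<le> m" and "\<And>i. i \<in> I \<Longrightarrow> card (A i) \<le> c"
  shows "card (\<Union>i\<in>I. A i) \<le> m * c"
proof -
  have "card (\<Union>i\<in>I. A i) \<le> (\<Sum>i\<in>I. card (A i))"
    using assms(1) by (rule card_UN_le)
  also have "\<dots> \<le> (\<Sum>i\<in>I. c)"
    using assms(3) by (rule sum_mono)
  also have "\<dots> \<le> m * c"
    using assms(2) by simp
  finally show ?thesis .
qed

lemma card_branches:
  assumes "\<And>E. finite (Q E) \<and> card (Q E) \<le> m" and "\<And>a. finite (V a) \<and> card (V a) \<le> k"
  shows "finite (branches Q V j) \<and> card (branches Q V j) \<le> (m * k) ^ j"
proof (induction j)
  case (Suc j)
  have "card (branches Q V (Suc j)) \<le> (m * k) ^ j * (m * (k * 1))"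
    unfolding branches.simps using Suc assms by (intro card_UN_le_mult) auto
  then show ?case
    using Suc assms by (simp add: mult.commute)
qed simp

text \<open>Every attribute of a rule \<open>r\<close> is found by extending a subset of the equations of \<open>r\<close>, starting from the
  empty set, one queried equation at a time.\<close>

lemma n_of_le_branching:
  assumes S: "S \<in> rule_systems" and Q: "\<And>E. finite (Q E) \<and> card (Q E) \<le> m"
    and next_eq: "\<And>r E. r \<in> S \<Longrightarrow> E \<subset> eqs r \<Longrightarrow> \<exists>(a, \<delta>)\<in>eqs r - E. a \<in> Q E"
  shows "n_of S \<le> (\<Sum>j<d_of S. (m * k_of S) ^ j * m)"
proof -
  define X where "X = branches Q (vals S)"
  have X: "finite (X j)" "card (X j) \<le> (m * k_of S) ^ j" for j
    using card_branches[of Q m "vals S" "k_of S" j] Q finite_vals[OF S] card_vals_le_k_of[OF S]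
    by (auto simp: X_def)
  \<comment> \<open>Besides its size, \<open>E\<close> remembers that each of its attributes was
    queried at an earlier level; this gives the covering of \<open>attrs S\<close> below.\<close>
  have chain: "\<exists>E\<in>X j. E \<subseteq> eqs r \<and> card E = j \<and> fst ` E \<subseteq> (\<Union>i<j. \<Union>E\<in>X i. Q E)"
    if r: "r \<in> S" and "j \<le> card (eqs r)" for r j
    using that(2)
  proof (induction j)
    case 0
    then show ?case
      by (simp add: X_def)
  next
    case (Suc j)
    then obtain E where E: "E \<in> X j" "E \<subseteq> eqs r" "card E = j" "fst ` E \<subseteq> (\<Union>i<j. \<Union>E\<in>X i. Q E)"
      by auto
    then have "E \<subset> eqs r"
      using Suc.prems by auto
    then obtain a \<delta> where a: "(a, \<delta>) \<in> eqs r" "(a, \<delta>) \<notin> E" "a \<in> Q E"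
      using next_eq[OF r] by blast
    have "finite E"
      using E(2) finite_eqs[OF S r] finite_subset by blast
    then have "card (insert (a, \<delta>) E) = Suc j"
      using a E by simp
    moreover have "insert (a, \<delta>) E \<in> X (Suc j)"
      using a E(1) eqs_vals[OF r a(1)] unfolding X_def branches.simps by blast
    moreover have "fst ` insert (a, \<delta>) E \<subseteq> (\<Union>i<Suc j. \<Union>E\<in>X i. Q E)"
      using a E(1,4) by (auto simp: lessThan_Suc)
    ultimately show ?case
      using a(1) E(2) by (intro bexI[of _ "insert (a, \<delta>) E"]) auto
  qed
  have "attrs S \<subseteq> (\<Union>j<d_of S. \<Union>E\<in>X j. Q E)"
  proof
    fix a assume "a \<in> attrs S"
    then obtain r where r: "r \<in> S" "a \<in> fst ` eqs r"
      by (auto simp: attrs_def)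
    obtain E where E: "E \<subseteq> eqs r" "card E = card (eqs r)"
        "fst ` E \<subseteq> (\<Union>i<card (eqs r). \<Union>E\<in>X i. Q E)"
      using chain[OF r(1) order_refl] by blast
    have "E = eqs r"
      using E finite_eqs[OF S r(1)] card_subset_eq by blast
    then have "a \<in> fst ` E"
      using r(2) by simp
    then have "a \<in> (\<Union>i<card (eqs r). \<Union>E\<in>X i. Q E)"
      by (rule subsetD[OF E(3)])
    then show "a \<in> (\<Union>j<d_of S. \<Union>E\<in>X j. Q E)"
      using card_eqs_le_d_of[OF S r(1)] by fastforce
  qed
  then have "n_of S \<le> card (\<Union>j<d_of S. \<Union>E\<in>X j. Q E)"
    unfolding n_of_def using X Q by (intro card_mono) auto
  also have "\<dots> \<le> (\<Sum>j<d_of S. card (\<Union>E\<in>X j. Q E))"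
    by (rule card_UN_le) simp
  also have "\<dots> \<le> (\<Sum>j<d_of S. (m * k_of S) ^ j * m)"
    using X Q by (intro sum_mono card_UN_le_mult) auto
  finally show ?thesis .
qed

text \<open>Absorbs the geometric sum over the levels into one power; the induction step rests on
  \<open>x ^ Suc d \<le> x * (x + 1) ^ d\<close>.\<close>

lemma sum_powers_less: "(\<Sum>j<d. x ^ Suc j) < (x + 1 :: nat) ^ d"
proof (induction d)
  case (Suc d)
  have "x ^ Suc d \<le> x * (x + 1) ^ d"
    by (cases "x = 0") (simp_all add: power_mono)
  then show ?case
    using Suc by (simp only: sum.lessThan_Suc power_Suc[of "x + 1"] distrib_right)
qed simp

lemma n_of_k_of_le_power:
  assumes S: "S \<in> rule_systems" "n_of S > 0" and min: "minimal_rules C S" and C: "C \<in> {ESR, EAD}"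
  shows "n_of S * k_of S \<le> ((h C S + 1) * k_of S) ^ d_of S"
proof -
  have "\<exists>Q. finite Q \<and> card Q \<le> h C S \<and> (\<forall>r\<in>S. E \<subset> eqs r \<longrightarrow> (\<exists>(a, \<delta>)\<in>eqs r - E. a \<in> Q))" for E
  proof (cases "\<exists>r\<in>S. E \<subset> eqs r")
    case True
    then obtain r0 where r0: "r0 \<in> S" "E \<subset> eqs r0"
      by blast
    have sv: "consistent E"
      using consistent_eqs[OF S(1) r0(1)] r0(2) single_valued_subset by blast
    obtain f where f: "\<And>a \<delta>. f a = Some \<delta> \<longleftrightarrow> (a, \<delta>) \<in> E"
      using consistent_imp_partial_function[OF sv] by blast
    have "f a \<in> labels C S a" for a
    proof (cases "f a")
      case None
      then show ?thesis
        using C by (auto simp: labels_def e_labels_def)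
    next
      case (Some \<delta>)
      then show ?thesis
        using f[of a \<delta>] r0 eqs_vals[OF r0(1), of a \<delta>] by auto
    qed
    then obtain Q where Q: "finite Q" "card Q \<le> h C S" "decided C S (answers f Q)"
      using h_answers[OF S] by metis
    have "\<exists>(a, \<delta>)\<in>eqs r - E. a \<in> Q" if r: "r \<in> S" "E \<subset> eqs r" for r
      using S(1) Q(3) r(1)
    proof (cases rule: decided_answers_cases)
      \<comment> \<open>The realized rule lies inside \<open>E\<close>, hence properly inside
        \<open>r\<close>, against minimality. So \<open>r\<close> is refuted, which can only happen
        at an equation outside \<open>E\<close>.\<close>
      case (covered r')
      then have "eqs r' \<subseteq> E"
        using ext_eqs_subset_answersD f by fast
      then show ?thesis
        using covered r min unfolding minimal_rules_def by blast
    next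
      case (refuted a \<delta>)
      then show ?thesis
        using f by blast
    qed
    then show ?thesis
      using Q by blast
  qed auto
  then obtain Q where "\<And>E. finite (Q E) \<and> card (Q E) \<le> h C S"
    "\<And>r E. r \<in> S \<Longrightarrow> E \<subset> eqs r \<Longrightarrow> \<exists>(a, \<delta>)\<in>eqs r - E. a \<in> Q E"
    by metis
  then have "n_of S \<le> (\<Sum>j<d_of S. (h C S * k_of S) ^ j * h C S)"
    using n_of_le_branching[OF S(1)] by blast
  then have "n_of S * k_of S \<le> (\<Sum>j<d_of S. (h C S * k_of S) ^ j * h C S) * k_of S"
    by simp
  also have "\<dots> = (\<Sum>j<d_of S. (h C S * k_of S) ^ Suc j)"
    by (simp add: sum_distrib_left sum_distrib_right mult_ac)
  also have "\<dots> \<le> (h C S * k_of S + 1) ^ d_of S"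
    using sum_powers_less by (rule less_imp_le)
  \<comment> \<open>Since \<open>k_of S\<close> is at least 1, the summand 1 fits into one more copy
    of it.\<close>
  also have "\<dots> \<le> ((h C S + 1) * k_of S) ^ d_of S"
  proof (rule power_mono)
    obtain a where "a \<in> attrs S"
      using S(2) by (fastforce simp: n_of_def card_gt_0_iff)
    then have "card (vals S a) > 0"
      using finite_vals[OF S(1)] vals_nonempty by (simp add: card_gt_0_iff)
    then have "k_of S > 0"
      using card_vals_le_k_of[OF S(1), of a] by simp
    then show "h C S * k_of S + 1 \<le> (h C S + 1) * k_of S"
      by simp
  qed simp
  finally show ?thesis .
qed

section \<open>Extremal systems\<close>

definition systems :: "nat \<Rightarrow> nat \<Rightarrow> nat \<Rightarrow> rule set set" where
  "systems n d k = {S \<in> rule_systems. n_of S = n \<and> d_of S = d \<and> k_of S = k}"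

lemma h_min_le: "S \<in> systems n d k \<Longrightarrow> h C S \<le> m \<Longrightarrow> h_min C n d k \<le> m"
  unfolding h_min_def systems_def by (rule order_trans[OF Least_le]) auto

lemma h_min_attained:
  assumes "systems n d k \<noteq> {}"
  obtains S where "S \<in> systems n d k" "h_min C n d k = h C S"
proof -
  have "\<exists>m. \<exists>S\<in>rule_systems. n_of S = n \<and> d_of S = d \<and> k_of S = k \<and> h C S = m"
    using assms by (auto simp: systems_def)
  from LeastI_ex[OF this] show ?thesis
    using that unfolding h_min_def systems_def by auto
qed

lemma hR_min_le:
  assumes "S \<in> systems n d k" and "minimal_rules C S" and "C \<in> {SR, ESR, AD, EAD}" and "h C S \<le> m"
  shows "hR_min C n d k \<le> m"
  unfolding hR_min_def using assms reduced_for_iff[OF assms(3)]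
  by (intro order_trans[OF Least_le assms(4)]) (auto simp: systems_def)

lemma hR_min_attained:
  assumes "S0 \<in> systems n d k" and "minimal_rules C S0" and "C \<in> {SR, ESR, AD, EAD}"
  obtains S where "S \<in> systems n d k" "minimal_rules C S" "hR_min C n d k = h C S"
proof -
  have "\<exists>m. \<exists>S\<in>rule_systems. reduced_for C S \<and> n_of S = n \<and> d_of S = d \<and> k_of S = k \<and> h C S = m"
    using assms reduced_for_iff[OF assms(3)] by (auto simp: systems_def)
  from LeastI_ex[OF this] show ?thesis
    using that reduced_for_iff[OF assms(3)] unfolding hR_min_def systems_def by auto
qed

lemma systemsI:
  assumes S: "S \<in> rule_systems" and "attrs S = {..<n}" and "0 < n"
    and "\<And>r. r \<in> S \<Longrightarrow> card (eqs r) \<le> d" and "r \<in> S" and "card (eqs r) = d"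
    and V: "\<And>a. vals S a \<subseteq> {..<k}" and "a < n" and "vals S a = {..<k}"
  shows "S \<in> systems n d k"
proof -
  have n: "n_of S = n"
    using assms(2) by (simp add: n_of_def)
  have "d_of S = d"
    unfolding d_of_def using S assms(4-6) by (intro Max_eqI) (auto simp: rule_systems_def)
  moreover have "Max ((\<lambda>a. card (vals S a)) ` attrs S) = k"
  proof (rule Max_eqI)
    show "k \<in> (\<lambda>a. card (vals S a)) ` attrs S"
      using assms(2,8,9) by (intro image_eqI[of _ _ a]) auto
    show "m \<le> k" if "m \<in> (\<lambda>a. card (vals S a)) ` attrs S" for m
      using that card_mono[OF _ V] by auto
  qed (simp add: assms(2))
  ultimately show ?thesis
    using S n assms(3) by (simp add: systems_def k_of_def)
qed

section \<open>Systems with one long rule\<close>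

text \<open>The long rule provides \<open>d\<close>, the rules at attribute 0 provide the
  \<open>k\<close> values, and the last family provides the missing attributes. With a common
  right-hand side every realized rule covers all others for AD too.\<close>

definition simple_system :: "nat \<Rightarrow> nat \<Rightarrow> nat \<Rightarrow> rule set" where
  "simple_system n d k = {Rule ((\<lambda>i. (i, 0)) ` {..<d}) 0} \<union> (\<lambda>\<delta>. Rule {(0, \<delta>)} 0) ` {1..<k} \<union>
     (\<lambda>j. Rule {(j, 0)} 0) ` {d..<n}"

lemma rhs_simple_system: "r \<in> simple_system n d k \<Longrightarrow> rhs r = 0"
  by (auto simp: simple_system_def)

lemma simple_system_rule_systems: "simple_system n d k \<in> rule_systems"
  by (auto simp: rule_systems_def simple_system_def is_rule_def single_valued_def)

lemma
  assumes "0 < d" and "d \<le> n" and "0 < k"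
  shows attrs_simple_system: "attrs (simple_system n d k) = {..<n}"
    and vals_simple_system: "vals (simple_system n d k) a =
      (if a = 0 then {..<k} else if a < n then {0} else {})"
proof -
  show "attrs (simple_system n d k) = {..<n}"
    using assms by (auto simp: attrs_def simple_system_def image_image)
  have "(\<Union>r\<in>simple_system n d k. eqs r) = (\<lambda>i. (i, 0)) ` {..<n} \<union> (\<lambda>\<delta>. (0, \<delta>)) ` {..<k}"
    using assms by (auto simp: simple_system_def image_iff Suc_le_eq)
  then show "vals (simple_system n d k) a = (if a = 0 then {..<k} else if a < n then {0} else {})"
    using assms by (auto simp: vals_def)
qed

lemma card_simple_system_rule:
  assumes "0 < d" and "r \<in> simple_system n d k"
  shows "card (eqs r) \<le> d"
proof -
  have "card ((\<lambda>i. (i, 0::nat)) ` {..<d}) = d"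
    by (subst card_image) (auto simp: inj_on_def)
  then show ?thesis
    using assms by (auto simp: simple_system_def)
qed

lemma simple_system_systems:
  assumes "0 < d" and "d \<le> n" and "0 < k"
  shows "simple_system n d k \<in> systems n d k"
proof (rule systemsI[where a = 0 and r = "Rule ((\<lambda>i. (i, 0)) ` {..<d}) 0"])
  show "card (eqs (Rule ((\<lambda>i. (i, 0)) ` {..<d}) 0)) = d"
    by (simp add: card_image inj_on_def)
qed (use assms card_simple_system_rule simple_system_rule_systems
      attrs_simple_system[OF assms] vals_simple_system[OF assms] in
    \<open>auto simp: simple_system_def split: if_splits\<close>)

text \<open>Only the long rule can have more than one equation, and the other rules avoid its
  equations by their value at attribute 0 or by their attribute.\<close>

lemma simple_system_minimal:
  assumes "0 < d"
  shows "minimal_rules C (simple_system n d k)"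
proof -
  have "\<not> eqs r' \<subset> eqs r" if "r \<in> simple_system n d k" "r' \<in> simple_system n d k" for r r'
  proof
    assume sub: "eqs r' \<subset> eqs r"
    have "finite (eqs r)" and "eqs r' \<noteq> {}"
      using that assms by (auto simp: simple_system_def)
    then have "card (eqs r) > 1"
      using psubset_card_mono[OF _ sub] sub by (metis Suc_leI One_nat_def card_gt_0_iff finite_subset le_less_trans psubset_imp_subset)
    then have "r = Rule ((\<lambda>i. (i, 0)) ` {..<d}) 0"
      using that(1) by (auto simp: simple_system_def)
    then show False
      using sub that(2) by (auto simp: simple_system_def)
  qed
  then show ?thesis
    by (auto simp: minimal_rules_def)
qed

text \<open>The attribute \<open>n - 1\<close> lies off the long rule and has 0 as its only value,
  so in an o-tree the single possible answer realizes a rule covering all others.\<close>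

lemma h_simple_system:
  assumes "0 < d" and "d < n" and "0 < k" and C: "C \<in> {SR, AD}"
  shows "h C (simple_system n d k) \<le> 1"
proof -
  let ?S = "simple_system n d k"
  have S: "?S \<in> rule_systems" "n_of ?S > 0"
    using simple_system_systems[of d n k] assms by (auto simp: systems_def)
  have "decided C ?S {(n - 1, Some 0)}"
    unfolding decided_def
  proof (intro ballI impI)
    fix r assume "r \<in> ?S"
    then have "covers C r (Rule {(n - 1, 0)} 0)"
      using C rhs_simple_system by (auto simp: covers_def)
    moreover have "Rule {(n - 1, 0)} 0 \<in> ?S"
      using assms by (auto simp: simple_system_def)
    ultimately show "\<exists>r'\<in>?S. covers C r r' \<and> ext_eqs r' \<subseteq> {(n - 1, Some 0)}"
      by (intro bexI[of _ "Rule {(n - 1, 0)} 0"]) (auto simp: ext_eqs_def)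
  qed
  moreover have "labels C ?S (n - 1) = {Some 0}"
    using assms vals_simple_system[of d n k] by (auto simp: labels_def o_labels_def)
  moreover have "n - 1 \<in> attrs ?S"
    using assms attrs_simple_system[of d n k] by simp
  ultimately have "solvable C ?S (Suc 0) {}"
    unfolding solvable.simps by (intro disjI2 bexI[of _ "n - 1"]) auto
  then show ?thesis
    using h_le_iff[OF S] by simp
qed

lemma insert_empty_rule_systems:
  assumes "S \<in> systems n d k" and "0 < n"
  shows "insert (Rule {} 0) S \<in> systems n d k"
proof -
  let ?S = "insert (Rule {} 0) S"
  have "attrs ?S = attrs S" "vals ?S = vals S"
    by (auto simp: attrs_def vals_def fun_eq_iff)
  then have "n_of ?S = n_of S" "k_of ?S = k_of S"
    by (simp_all add: n_of_def k_of_def)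
  moreover have "d_of ?S = d_of S"
    using assms by (auto simp: systems_def rule_systems_def d_of_def)
  moreover have "?S \<in> rule_systems"
    using assms by (auto simp: systems_def rule_systems_def is_rule_def)
  ultimately show ?thesis
    using assms by (simp add: systems_def)
qed

text \<open>The empty rule is realized before any query and, by the common right-hand side, covers
  every rule.\<close>

lemma h_insert_empty_rule:
  assumes "S \<in> systems n d k" and "0 < n" and "\<And>r. r \<in> S \<Longrightarrow> rhs r = 0"
    and "C \<in> {SR, ESR, AD, EAD}"
  shows "h C (insert (Rule {} 0) S) = 0"
proof -
  let ?S = "insert (Rule {} 0) S"
  have S: "?S \<in> rule_systems" "n_of ?S > 0"
    using insert_empty_rule_systems[OF assms(1,2)] assms(2) by (auto simp: systems_def)
  have "decided C ?S {}"
    unfolding decided_def using assms(3,4)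
    by (intro ballI impI bexI[of _ "Rule {} 0"]) (auto simp: covers_def ext_eqs_def)
  then show ?thesis
    using h_le_iff[OF S, of C 0] by simp
qed

section \<open>Digits, residue classes and the layered system\<close>

lemma mod_power_eqI:
  fixes x y b :: nat
  assumes "\<And>i. i < m \<Longrightarrow> (x div b ^ i) mod b = (y div b ^ i) mod b"
  shows "x mod b ^ m = y mod b ^ m"
  using assms
proof (induction m)
  case (Suc m)
  then have "x mod b ^ m = y mod b ^ m" "(x div b ^ m) mod b = (y div b ^ m) mod b"
    by auto
  then show ?case
    by (simp add: power_Suc2 mod_mult2_eq del: power_Suc)
qed simp

text \<open>Within one residue class the quotient by \<open>P\<close> identifies the
  element.\<close>

lemma card_congruent_le:
  fixes A :: "nat set"
  assumes "A \<subseteq> {..<n}" and "\<And>x y. x \<in> A \<Longrightarrow> y \<in> A \<Longrightarrow> x mod P = y mod P"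
  shows "card A \<le> n div P + 1"
proof -
  have "inj_on (\<lambda>x. x div P) A"
    using assms(2) by (intro inj_onI) (metis div_mult_mod_eq)
  moreover have "(\<lambda>x. x div P) ` A \<subseteq> {..n div P}"
    using assms(1) by (auto intro!: div_le_mono)
  ultimately have "card A \<le> card {..n div P}"
    by (intro card_inj_on_le) auto
  then show ?thesis
    by simp
qed

text \<open>The attributes below \<open>(d - 1) * t\<close> form \<open>d - 1\<close> levels of \<open>t\<close> attributes each. The digits of \<open>j\<close> in
  base \<open>t * k\<close> select one equation per level, and these equations are the prefix of the rules for the
  attribute \<open>j\<close>.\<close>

definition level_eq :: "nat \<Rightarrow> nat \<Rightarrow> nat \<Rightarrow> nat \<Rightarrow> nat \<times> nat" where
  "level_eq k t j i =
     (i * t + (j div (t * k) ^ i) mod (t * k) div k, (j div (t * k) ^ i) mod (t * k) mod k)"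

definition prefix_rule :: "nat \<Rightarrow> nat \<Rightarrow> nat \<Rightarrow> nat \<Rightarrow> nat \<Rightarrow> rule" where
  "prefix_rule d k t j \<delta> = Rule (insert (j, \<delta>) (level_eq k t j ` {..<d - 1})) 0"

definition pair_rule :: "nat \<Rightarrow> nat \<Rightarrow> nat \<Rightarrow> nat \<Rightarrow> rule" where
  "pair_rule x \<delta> y \<epsilon> = Rule {(x, \<delta>), (y, \<epsilon>)} 0"

text \<open>With the pair rules, two answers different from \<open>*\<close> within one level realize a rule at once.
  So at most one prefix remains after all levels have been queried.\<close>

definition layered_system :: "nat \<Rightarrow> nat \<Rightarrow> nat \<Rightarrow> nat \<Rightarrow> rule set" where
  "layered_system n d k t =
     {prefix_rule d k t j \<delta> | j \<delta>. (d - 1) * t \<le> j \<and> j < n \<and> \<delta> < k} \<union>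
     {pair_rule x \<delta> y \<epsilon> | x \<delta> y \<epsilon>. x < y \<and> y < (d - 1) * t \<and> x div t = y div t \<and> \<delta> < k \<and> \<epsilon> < k}"

lemma eqs_prefix_rule [simp]:
  "eqs (prefix_rule d k t j \<delta>) = insert (j, \<delta>) (level_eq k t j ` {..<d - 1})"
  by (simp add: prefix_rule_def)

lemma eqs_pair_rule [simp]: "eqs (pair_rule x \<delta> y \<epsilon>) = {(x, \<delta>), (y, \<epsilon>)}"
  by (simp add: pair_rule_def)

lemma rhs_layered_system: "r \<in> layered_system n d k t \<Longrightarrow> rhs r = 0"
  by (auto simp: layered_system_def prefix_rule_def pair_rule_def)

text \<open>The strict bound on \<open>n\<close> leaves the attribute \<open>n - 1\<close> above all
  levels; its rules witness the length \<open>d\<close> and the \<open>k\<close> values.\<close>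

locale layered =
  fixes n d k t :: nat
  assumes d: "2 \<le> d" and k: "0 < k" and t: "0 < t" and n: "(d - 1) * t < n"
begin

abbreviation "S \<equiv> layered_system n d k t"

lemma digit_div_less: "(j div (t * k) ^ i) mod (t * k) div k < t"
  using k t by (simp add: less_mult_imp_div_less)

lemma snd_level_eq_less: "snd (level_eq k t j i) < k"
  using k by (simp add: level_eq_def)

lemma fst_level_eq_div: "fst (level_eq k t j i) div t = i"
  using digit_div_less[of j i] t by (simp add: level_eq_def)

lemma fst_level_eq_less:
  assumes "i < d - 1"
  shows "fst (level_eq k t j i) < (d - 1) * t"
proof -
  have "fst (level_eq k t j i) div t < d - 1"
    using assms fst_level_eq_div by simp
  then show ?thesis
    using t by (simp add: div_less_iff_less_mult)
qed

lemma level_eq_inj: "level_eq k t j i = level_eq k t j' i' \<Longrightarrow> i = i'"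
  using fst_level_eq_div by metis

lemma layered_system_cases:
  assumes "r \<in> S"
  obtains (prefix) j \<delta> where "r = prefix_rule d k t j \<delta>" "(d - 1) * t \<le> j" "j < n" "\<delta> < k"
  | (pair) x \<delta> y \<epsilon> where "r = pair_rule x \<delta> y \<epsilon>" "x < y" "y < (d - 1) * t" "x div t = y div t" "\<delta> < k" "\<epsilon> < k"
  using assms unfolding layered_system_def by blast

lemma card_prefix_rule:
  assumes "(d - 1) * t \<le> j"
  shows "card (eqs (prefix_rule d k t j \<delta>)) = d"
proof -
  have "inj_on (level_eq k t j) {..<d - 1}"
    using level_eq_inj by (auto intro: inj_onI)
  moreover have "(j, \<delta>) \<notin> level_eq k t j ` {..<d - 1}"
    using fst_level_eq_less[of _ j] assms by (metis (no_types) fst_conv imageE lessThan_iff not_le)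
  ultimately show ?thesis
    using d by (simp add: card_image)
qed

lemma consistent_prefix_rule:
  assumes "(d - 1) * t \<le> j"
  shows "consistent (eqs (prefix_rule d k t j \<delta>))"
proof -
  have "v = w" if "(a, v) = level_eq k t j i" "(a, w) = level_eq k t j i'" for a v w i i'
    using that fst_level_eq_div by (metis fst_conv snd_conv)
  moreover have "(j, v) \<noteq> level_eq k t j i" if "i < d - 1" for v i
    using fst_level_eq_less[OF that, of j] assms by (metis fst_conv not_le)
  ultimately show ?thesis
    unfolding single_valued_def by (auto simp: image_iff)
qed

lemma finite_layered_system: "finite S"
proof -
  have "S \<subseteq> (\<lambda>(j, \<delta>). prefix_rule d k t j \<delta>) ` ({..<n} \<times> {..<k}) \<union>
      (\<lambda>((x, \<delta>), (y, \<epsilon>)). pair_rule x \<delta> y \<epsilon>) ` (({..<n} \<times> {..<k}) \<times> ({..<n} \<times> {..<k}))"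
  proof
    fix r assume "r \<in> S"
    then show "r \<in> (\<lambda>(j, \<delta>). prefix_rule d k t j \<delta>) ` ({..<n} \<times> {..<k}) \<union>
      (\<lambda>((x, \<delta>), (y, \<epsilon>)). pair_rule x \<delta> y \<epsilon>) ` (({..<n} \<times> {..<k}) \<times> ({..<n} \<times> {..<k}))"
    proof (cases rule: layered_system_cases)
      case (prefix j \<delta>)
      then show ?thesis
        by (intro UnI1 image_eqI[of _ _ "(j, \<delta>)"]) auto
    next
      case (pair x \<delta> y \<epsilon>)
      then show ?thesis
        using n by (intro UnI2 image_eqI[of _ _ "((x, \<delta>), (y, \<epsilon>))"]) auto
    qed
  qed
  then show ?thesis
    by (rule finite_subset) auto
qed

lemma prefix_rule_in: "(d - 1) * t \<le> j \<Longrightarrow> j < n \<Longrightarrow> \<delta> < k \<Longrightarrow> prefix_rule d k t j \<delta> \<in> S"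
  by (auto simp: layered_system_def)

lemma pair_rule_in:
  "x < y \<Longrightarrow> y < (d - 1) * t \<Longrightarrow> x div t = y div t \<Longrightarrow> \<delta> < k \<Longrightarrow> \<epsilon> < k \<Longrightarrow> pair_rule x \<delta> y \<epsilon> \<in> S"
  unfolding layered_system_def by blast

lemma layered_system_rule_systems: "S \<in> rule_systems"
proof -
  have "is_rule r" if "r \<in> S" for r
    using that
  proof (cases rule: layered_system_cases)
    case (prefix j \<delta>)
    then show ?thesis
      using consistent_prefix_rule by (simp add: is_rule_def)
  next
    case pair
    then show ?thesis
      by (auto simp: is_rule_def single_valued_def)
  qed
  moreover have "S \<noteq> {}"
    using prefix_rule_in[of "n - 1" 0] n k by fastforce
  ultimately show ?thesis
    using finite_layered_system by (simp add: rule_systems_def)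
qed

lemma level_partner:
  assumes "t \<noteq> 1"
  obtains y where "y \<noteq> x" "y div t = x div t"
proof -
  \<comment> \<open>The first attribute in the level of \<open>x\<close>, or the second one if
    \<open>x\<close> is the first.\<close>
  define y where "y = x div t * t + (if x mod t = 0 then 1 else 0)"
  have "y div t = x div t"
    using t assms unfolding y_def by (auto simp: div_mult_self3)
  moreover have "y mod t \<noteq> x mod t"
    using t assms unfolding y_def by (auto simp: mod_mult_self3)
  ultimately show ?thesis
    using that by metis
qed

lemma attrs_layered_system: "attrs S = {..<n}"
proof
  show "attrs S \<subseteq> {..<n}"
  proof
    fix a assume "a \<in> attrs S"
    then obtain r where r: "r \<in> S" "a \<in> fst ` eqs r"
      by (auto simp: attrs_def)
    from r(1) show "a \<in> {..<n}"
    proof (cases rule: layered_system_cases)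
      case (prefix j \<delta>)
      then have "a = j \<or> (\<exists>i<d - 1. a = fst (level_eq k t j i))"
        using r(2) by auto
      then show ?thesis
        using prefix fst_level_eq_less[of _ j] n by (metis lessThan_iff less_trans)
    next
      case pair
      then show ?thesis
        using r(2) n by auto
    qed
  qed
  show "{..<n} \<subseteq> attrs S"
  proof
    fix a assume a: "a \<in> {..<n}"
    \<comment> \<open>Attributes above the levels have their own prefix rules; for
      \<open>t = 1\<close> each level is a single attribute occurring in every prefix; in larger
      levels a pair rule contains the attribute.\<close>
    consider "(d - 1) * t \<le> a" | "a < (d - 1) * t" "t = 1" | "a < (d - 1) * t" "t \<noteq> 1"
      by linarith
    then show "a \<in> attrs S"
    proof cases
      case 1
      then show ?thesis
        using prefix_rule_in[of a 0] a k eqs_attrs[of "prefix_rule d k t a 0" S a 0] by simp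
    next
      case 2
      have "(a, snd (level_eq k t (n - 1) a)) = level_eq k t (n - 1) a"
        using fst_level_eq_div[of "n - 1" a] 2 by (simp add: prod_eq_iff)
      then have "(a, snd (level_eq k t (n - 1) a)) \<in> eqs (prefix_rule d k t (n - 1) 0)"
        using 2 by simp
      moreover have "prefix_rule d k t (n - 1) 0 \<in> S"
        using prefix_rule_in n k by simp
      ultimately show ?thesis
        using eqs_attrs by blast
    next
      case 3
      obtain y where y: "y \<noteq> a" "y div t = a div t"
        using level_partner[OF 3(2)] .
      then have "y < (d - 1) * t"
        using 3(1) t by (metis div_less_iff_less_mult)
      then have "pair_rule (min a y) 0 (max a y) 0 \<in> S"
        using y 3(1) k by (intro pair_rule_in) (auto simp: min_def max_def)
      moreover have "(a, 0) \<in> eqs (pair_rule (min a y) 0 (max a y) 0)"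
        by (auto simp: min_def max_def)
      ultimately show ?thesis
        by (rule eqs_attrs)
    qed
  qed
qed

lemma vals_layered_system: "vals S a \<subseteq> {..<k}"
proof
  fix v assume "v \<in> vals S a"
  then obtain r where r: "r \<in> S" "(a, v) \<in> eqs r"
    by (auto simp: vals_def)
  from r(1) show "v \<in> {..<k}"
  proof (cases rule: layered_system_cases)
    case (prefix j \<delta>)
    then have "v = \<delta> \<or> (\<exists>i<d - 1. v = snd (level_eq k t j i))"
      using r(2) by auto (metis snd_conv)
    then show ?thesis
      using prefix snd_level_eq_less by auto
  next
    case pair
    then show ?thesis
      using r(2) by auto
  qed
qed

lemma layered_system_systems: "S \<in> systems n d k"
proof (rule systemsI)
  show "S \<in> rule_systems" "attrs S = {..<n}" "vals S a \<subseteq> {..<k}" for a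
    by (fact layered_system_rule_systems attrs_layered_system vals_layered_system)+
  show "card (eqs r) \<le> d" if "r \<in> S" for r
    using that
  proof (cases rule: layered_system_cases)
    case (prefix j \<delta>)
    then show ?thesis
      using card_prefix_rule by simp
  next
    case pair
    then show ?thesis
      using d by simp
  qed
  show "prefix_rule d k t (n - 1) 0 \<in> S" "card (eqs (prefix_rule d k t (n - 1) 0)) = d"
    using prefix_rule_in card_prefix_rule n k by auto
  show "n - 1 < n" "0 < n"
    using n by auto
  show "vals S (n - 1) = {..<k}"
  proof
    show "{..<k} \<subseteq> vals S (n - 1)"
    proof
      fix v assume "v \<in> {..<k}"
      then have "prefix_rule d k t (n - 1) v \<in> S"
        using prefix_rule_in n by auto
      then show "v \<in> vals S (n - 1)"
        by (rule eqs_vals) simp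
    qed
  qed (fact vals_layered_system)
qed

text \<open>Every rule has at least 2 and at most \<open>d\<close> equations, and a prefix rule
  exactly \<open>d\<close>. So a proper inclusion would put a pair rule into a prefix rule, which
  has only one attribute in each level.\<close>

lemma layered_system_minimal: "minimal_rules C S"
proof -
  have "\<not> eqs r' \<subset> eqs r" if r: "r \<in> S" "r' \<in> S" for r r'
  proof
    assume sub: "eqs r' \<subset> eqs r"
    have less: "card (eqs r') < card (eqs r)"
      using psubset_card_mono[OF finite_eqs[OF layered_system_rule_systems r(1)] sub] .
    have le: "card (eqs r) \<le> d"
      using card_eqs_le_d_of[OF layered_system_rule_systems r(1)] layered_system_systems
      by (simp add: systems_def)
    have large: "card (eqs r') \<ge> 2"
      using r(2) by (cases rule: layered_system_cases) (use card_prefix_rule d in auto)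
    obtain j \<delta> where j: "r = prefix_rule d k t j \<delta>" "(d - 1) * t \<le> j"
      using r(1) less large by (cases rule: layered_system_cases) auto
    obtain x y v w where xy: "r' = pair_rule x v y w" "x < y" "y < (d - 1) * t" "x div t = y div t"
      using r(2) less le card_prefix_rule by (cases rule: layered_system_cases) auto
    have level: "a = fst (level_eq k t j (a div t))"
      if "(a, u) \<in> eqs r" "a < (d - 1) * t" for a u
    proof -
      have "(a, u) \<in> level_eq k t j ` {..<d - 1}"
        using that j by auto
      then obtain i where "a = fst (level_eq k t j i)"
        by (metis fst_conv imageE)
      then show ?thesis
        using fst_level_eq_div by simp
    qed
    have "(x, v) \<in> eqs r" "(y, w) \<in> eqs r"
      using sub xy by auto
    then have "x = y"
      using level xy by (metis less_trans)
    then show False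
      using xy by simp
  qed
  then show ?thesis
    by (simp add: minimal_rules_def)
qed

section \<open>Depth of the layered system\<close>

text \<open>With at most one answer other than \<open>*\<close> in each level, the answers determine
  the lowest \<open>d - 1\<close> digits of a matching \<open>j\<close>, hence its residue modulo
  \<open>(t * k) ^ (d - 1)\<close>.\<close>

lemma prefix_block_card:
  fixes f :: "nat \<Rightarrow> nat option"
  assumes uniq: "\<And>x y. x < y \<Longrightarrow> y < (d - 1) * t \<Longrightarrow> x div t = y div t \<Longrightarrow> f x = None \<or> f y = None"
  shows "card {j. j < n \<and> (\<forall>i<d - 1. f (fst (level_eq k t j i)) = Some (snd (level_eq k t j i)))}
    \<le> n div (t * k) ^ (d - 1) + 1"
proof (rule card_congruent_le)
  fix j j'
  assume j: "j \<in> {j. j < n \<and> (\<forall>i<d - 1. f (fst (level_eq k t j i)) = Some (snd (level_eq k t j i)))}"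
    and j': "j' \<in> {j. j < n \<and> (\<forall>i<d - 1. f (fst (level_eq k t j i)) = Some (snd (level_eq k t j i)))}"
  show "j mod (t * k) ^ (d - 1) = j' mod (t * k) ^ (d - 1)"
  proof (rule mod_power_eqI)
    fix i assume i: "i < d - 1"
    let ?x = "fst (level_eq k t j i)" and ?y = "fst (level_eq k t j' i)"
    have "f ?x \<noteq> None" "f ?y \<noteq> None"
      using j j' i by auto
    then have xy: "?x = ?y"
      using uniq[of ?x ?y] uniq[of ?y ?x] fst_level_eq_less[OF i] fst_level_eq_div
      by (metis linorder_neqE_nat)
    then have "Some (snd (level_eq k t j i)) = Some (snd (level_eq k t j' i))"
      using j j' i by (metis (mono_tags, lifting) mem_Collect_eq)
    then have "level_eq k t j i = level_eq k t j' i"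
      using xy by (simp add: prod_eq_iff)
    \<comment> \<open>A digit \<open>c\<close> is recovered from \<open>c div k\<close> and
      \<open>c mod k\<close>, that is, from the attribute and the value of its equation.\<close>
    then show "j div (t * k) ^ i mod (t * k) = j' div (t * k) ^ i mod (t * k)"
      unfolding level_eq_def by (metis add_left_cancel div_mult_mod_eq prod.inject)
  qed
qed auto

text \<open>All level attributes are asked first. Either two answers in one level realize a pair
  rule, or the only rules left open belong to one block, whose attributes are asked next.\<close>

lemma h_layered_system:
  assumes C: "t = 1 \<or> C \<in> {ESR, EAD}"
  shows "h C S \<le> (d - 1) * t + (n div (t * k) ^ (d - 1) + 1)"
proof -
  let ?m = "n div (t * k) ^ (d - 1) + 1"
  have "solvable C S (card {..<(d - 1) * t} + ?m) {}"
  proof (rule solvable_query)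
    show "{..<(d - 1) * t} \<subseteq> attrs S"
      using attrs_layered_system n by auto
    fix f assume f: "\<And>b. b \<in> {..<(d - 1) * t} \<Longrightarrow> f b \<in> labels C S b"
    let ?E = "answers f {..<(d - 1) * t}"
    show "solvable C S ?m ({} \<union> ?E)"
    proof (cases "\<exists>x y. x < y \<and> y < (d - 1) * t \<and> x div t = y div t \<and> f x \<noteq> None \<and> f y \<noteq> None")
      case True
      then obtain x y v w where xy: "x < y" "y < (d - 1) * t" "x div t = y div t"
        and fxy: "f x = Some v" "f y = Some w"
        by auto
      \<comment> \<open>Two attributes in one level exclude \<open>t = 1\<close>, so the problem is
        ESR or EAD, where one realized rule with the common right-hand side suffices.\<close>
      have "t \<noteq> 1"
        using xy by auto
      then have "C \<in> {ESR, EAD}"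
        using C by simp
      moreover have "v < k" "w < k"
        using f[of x] f[of y] xy fxy vals_layered_system by auto
      then have "pair_rule x v y w \<in> S"
        using xy by (intro pair_rule_in)
      moreover have "ext_eqs (pair_rule x v y w) \<subseteq> ?E"
        using xy fxy by (force simp: ext_eqs_def)
      ultimately have "decided C S ?E"
        unfolding decided_def covers_def using rhs_layered_system by (metis empty_iff insert_iff problem.distinct)
      then show ?thesis
        by (simp add: decided_imp_solvable)
    next
      case False
      \<comment> \<open>\<open>?B\<close> may include level attributes, which are then asked twice;
        if the answers differ, the play is inconsistent and hence decided.\<close>
      let ?B = "{j. j < n \<and> (\<forall>i<d - 1. f (fst (level_eq k t j i)) = Some (snd (level_eq k t j i)))}"
      have "solvable C S (card ?B + 0) ?E"
      proof (rule solvable_query)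
        show "?B \<subseteq> attrs S"
          using attrs_layered_system by auto
        fix g assume "\<And>b. b \<in> ?B \<Longrightarrow> g b \<in> labels C S b"
        have "ext_eqs r \<subseteq> ?E \<union> answers g ?B"
          if r: "r \<in> S" and cons: "consistent (ext_eqs r \<union> (?E \<union> answers g ?B))" for r
        proof (rule ext_eqs_subsetI[OF cons])
          fix a v assume a: "(a, v) \<in> eqs r"
          have fst: "fst ` (?E \<union> answers g ?B) = {..<(d - 1) * t} \<union> ?B"
            by (simp add: image_Un image_image)
          from r show "a \<in> fst ` (?E \<union> answers g ?B)"
            unfolding fst
          proof (cases rule: layered_system_cases)
            case (prefix j \<delta>)
            have "f (fst (level_eq k t j i)) = Some (snd (level_eq k t j i))" if i: "i < d - 1" for i
            proof (rule ccontr)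
              assume ne: "f (fst (level_eq k t j i)) \<noteq> Some (snd (level_eq k t j i))"
              have in_r: "(fst (level_eq k t j i), snd (level_eq k t j i)) \<in> eqs r"
                using i prefix(1) by simp
              have in_E: "(fst (level_eq k t j i), f (fst (level_eq k t j i))) \<in> ?E \<union> answers g ?B"
                using fst_level_eq_less[OF i] by auto
              show False
                using not_consistentI[OF in_r in_E ne] cons by contradiction
            qed
            then have "j \<in> ?B"
              using prefix by simp
            moreover have "a = j \<or> a < (d - 1) * t"
              using a prefix(1) fst_level_eq_less[of _ j] by (auto simp: image_iff) (metis fst_conv)
            ultimately show "a \<in> {..<(d - 1) * t} \<union> ?B"
              by blast
          next
            case pair
            then show "a \<in> {..<(d - 1) * t} \<union> ?B"
              using a by auto
          qed
        qed
        then have "decided C S (?E \<union> answers g ?B)"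
          unfolding decided_def using covers_refl by blast
        then show "solvable C S 0 (?E \<union> answers g ?B)"
          by simp
      qed simp
      moreover have "card ?B + 0 \<le> ?m"
        unfolding add_0_right using False by (intro prefix_block_card) blast
      ultimately show ?thesis
        unfolding Un_empty_left by (rule solvable_mono)
    qed
  qed simp
  then show ?thesis
    using h_le_iff[OF layered_system_rule_systems, of C] n layered_system_systems
    by (simp add: systems_def)
qed

end

section \<open>Bounds for given parameters\<close>

text \<open>Fixes the level size for the upper bounds on ESR and EAD: \<open>t * k\<close> is at
  least the \<open>d\<close>-th root of \<open>n * k\<close>.\<close>

lemma n_times_k_le_ceiling_power:
  fixes n d k :: nat
  assumes "0 < n" and "0 < d" and "0 < k"
  defines "t \<equiv> nat \<lceil>root d (real n * real k) / real k\<rceil>"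
  shows "0 < t" and "n * k \<le> (t * k) ^ d"
proof -
  let ?x = "root d (real n * real k)"
  have pos: "?x / real k > 0"
    using assms by simp
  then show "0 < t"
    by (simp add: t_def)
  have "?x / real k \<le> real t"
    using pos unfolding t_def by (simp add: le_of_int_ceiling)
  then have "?x \<le> real (t * k)"
    using assms(3) by (simp add: pos_divide_le_eq)
  then have "?x ^ d \<le> real (t * k) ^ d"
    using assms by (intro power_mono) auto
  then have "real (n * k) \<le> real ((t * k) ^ d)"
    using assms(2) by simp
  then show "n * k \<le> (t * k) ^ d"
    by (simp only: of_nat_le_iff)
qed

lemma root_bound:
  fixes n d k m :: nat
  assumes "0 < d" and "0 < k" and "n * k \<le> ((m + 1) * k) ^ d"
  shows "root d (real n * real k) / real k - real d \<le> real m"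
proof -
  have "real (n * k) \<le> real (((m + 1) * k) ^ d)"
    using assms(3) by (simp only: of_nat_le_iff)
  then have "root d (real n * real k) \<le> root d (real ((m + 1) * k) ^ d)"
    using assms(1) by (simp only: real_root_le_iff of_nat_mult of_nat_power)
  also have "\<dots> = real ((m + 1) * k)"
    using assms(1) by (simp add: real_root_power_cancel)
  finally have "root d (real n * real k) / real k \<le> real m + 1"
    using assms(2) by (simp add: pos_divide_le_eq distrib_right)
  \<comment> \<open>Subtracting \<open>d\<close> instead of 1 only weakens the bound, as
    \<open>d\<close> is positive.\<close>
  then show ?thesis
    using assms(1) by simp
qed

text \<open>For the upper bound the choice of \<open>t\<close> balances both phases: the block left
  after \<open>(d - 1) * t\<close> queries has at most \<open>t + 1\<close> attributes.\<close>

lemma hR_min_ESR_EAD_bounds: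
  fixes n d k :: nat
  assumes "0 < n" and "0 < d" and "0 < k" and "d \<le> n" and C: "C \<in> {ESR, EAD}"
  shows "max (real d) (root d (real n * real k) / real k - real d) \<le> real (hR_min C n d k)"
    and "real (hR_min C n d k) \<le> 2 * real d * real_of_int \<lceil>root d (real n * real k) / real k\<rceil>"
proof -
  have C': "C \<in> {SR, ESR, AD, EAD}"
    using C by auto
  note simple = simple_system_systems[OF assms(2,4,3)] simple_system_minimal[OF assms(2)]
  obtain S where S: "S \<in> systems n d k" "minimal_rules C S" "hR_min C n d k = h C S"
    using hR_min_attained[OF simple C'] .
  have SS: "S \<in> rule_systems" "n_of S = n" "d_of S = d" "k_of S = k"
    using S(1) by (auto simp: systems_def)
  have "n_of S * k_of S \<le> ((h C S + 1) * k_of S) ^ d_of S"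
    using n_of_k_of_le_power[OF SS(1) _ S(2) C] SS assms(1) by simp
  then have "root d (real n * real k) / real k - real d \<le> real (h C S)"
    using SS assms by (intro root_bound) auto
  moreover have "d \<le> h C S"
    using d_of_le_h[OF SS(1) _ S(2)] C SS assms(1) by auto
  ultimately show "max (real d) (root d (real n * real k) / real k - real d) \<le> real (hR_min C n d k)"
    using S(3) by simp
  define t where "t = nat \<lceil>root d (real n * real k) / real k\<rceil>"
  note t_bounds = n_times_k_le_ceiling_power[OF assms(1-3), folded t_def]
  have "hR_min C n d k \<le> 2 * d * t"
  \<comment> \<open>For such small \<open>n\<close>, asking all attributes of a reduced system is
    enough; otherwise \<open>n\<close> exceeds the number of level attributes, as the layered system
    requires.\<close>
  proof (cases "n \<le> 2 * d * t")
    case True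
    have "h C (simple_system n d k) \<le> n"
      using simple(1) h_le_n_of[of "simple_system n d k" C] assms(1) by (simp add: systems_def)
    then show ?thesis
      using True hR_min_le[OF simple C'] by (meson order_trans)
  next
    case False
    have n_le: "n \<le> t * (t * k) ^ (d - 1)"
    proof -
      have "n * k \<le> t * (t * k) ^ (d - 1) * k"
        using t_bounds(2) assms(2) by (cases d) (simp_all add: mult_ac)
      then show ?thesis
        using assms(3) by simp
    qed
    \<comment> \<open>For \<open>d = 1\<close> the estimate would read \<open>n \<le> t\<close>,
      contrary to the case assumption.\<close>
    have "d \<noteq> 1"
      using n_le False by auto
    moreover have "(d - 1) * t \<le> 2 * d * t"
      by (intro mult_right_mono) auto
    then have "(d - 1) * t < n"
      using False by linarith
    ultimately interpret layered n d k t
      using assms t_bounds(1) by unfold_locales auto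
    have "n div (t * k) ^ (d - 1) \<le> t * (t * k) ^ (d - 1) div (t * k) ^ (d - 1)"
      using n_le by (rule div_le_mono)
    also have "\<dots> = t"
      using t_bounds(1) assms(3) by simp
    finally have "h C (layered_system n d k t) \<le> (d - 1) * t + (t + 1)"
      using h_layered_system[of C] C by simp
    also have "\<dots> \<le> 2 * d * t"
    proof -
      have "(d - 1) * t + t = d * t"
        using assms(2) by (cases d) auto
      moreover have "0 < d * t"
        using assms(2) t_bounds(1) by simp
      ultimately show ?thesis
        by linarith
    qed
    finally show ?thesis
      using hR_min_le[OF layered_system_systems layered_system_minimal C'] by blast
  qed
  then have "real (hR_min C n d k) \<le> real (2 * d * t)"
    by (simp only: of_nat_le_iff)
  also have "\<dots> = 2 * real d * real_of_int \<lceil>root d (real n * real k) / real k\<rceil>"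
    using t_bounds(1) by (simp add: t_def)
  finally show "real (hR_min C n d k) \<le> 2 * real d * real_of_int \<lceil>root d (real n * real k) / real k\<rceil>" .
qed

theorem theorem2:
  fixes n d k :: nat
  assumes "n > 0" and "d > 0" and "k > 0" and "d \<le> n"
  shows
    "(h_min SR n d k = 0 \<and> h_min AD n d k = 0 \<and> h_min ESR n d k = 0 \<and> h_min EAD n d k = 0)
     \<and> (k = 1 \<or> d = 1 \<longrightarrow> h_min AR n d k = n \<and> h_min EAR n d k = n)
     \<and> (k \<ge> 2 \<and> d \<ge> 2 \<longrightarrow>
          max (real d) (real n * (real k - 1) / real k ^ d) \<le> real (h_min AR n d k)
          \<and> h_min AR n d k \<le> h_min EAR n d k
          \<and> real (h_min EAR n d k) \<le> real d + real n / real k ^ (d - 1))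
     \<and> (hR_min SR n d k = hR_min AD n d k
        \<and> hR_min SR n d k = (if d = n then n else 1))
     \<and> (max (real d) (root d (real n * real k) / real k - real d) \<le> real (hR_min ESR n d k)
        \<and> real (hR_min ESR n d k)
            \<le> 2 * real d * real_of_int \<lceil>root d (real n * real k) / real k\<rceil>)
     \<and> (max (real d) (root d (real n * real k) / real k - real d) \<le> real (hR_min EAD n d k)
        \<and> real (hR_min EAD n d k)
            \<le> 2 * real d * real_of_int \<lceil>root d (real n * real k) / real k\<rceil>)"
proof -
  note simple = simple_system_systems[OF assms(2,4,3)] simple_system_minimal[OF assms(2)]
  have nonempty: "systems n d k \<noteq> {}"
    using simple by auto
  have params: "S \<in> rule_systems" "n_of S = n" "d_of S = d" "k_of S = k" "n_of S > 0"
    if "S \<in> systems n d k" for S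
    using that assms(1) by (auto simp: systems_def)
  have h_le: "h C S \<le> n" if "S \<in> systems n d k" for C S
    using h_le_n_of[of S C] params[OF that] by simp

  have a: "h_min C n d k = 0" if C: "C \<in> {SR, ESR, AD, EAD}" for C
    using h_min_le[OF insert_empty_rule_systems[OF simple(1) assms(1)], of C 0]
      h_insert_empty_rule[OF simple(1) assms(1) rhs_simple_system C] by simp

  have AR_lower: "n \<le> h_min C n d k * k ^ (d - 1)" "d \<le> h_min C n d k"
    if C: "C \<in> {AR, EAR}" for C
  proof -
    obtain S where S: "S \<in> systems n d k" "h_min C n d k = h C S"
      using h_min_attained[OF nonempty] .
    show "n \<le> h_min C n d k * k ^ (d - 1)"
      using n_of_le_h_AR[OF _ _ C, of S] params[OF S(1)] S(2) by simp
    show "d \<le> h_min C n d k"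
      using d_of_le_h_AR[OF _ _ C, of S] params[OF S(1)] S(2) by simp
  qed

  \<comment> \<open>In both cases \<open>k ^ (d - 1) = 1\<close>, so the averaging bound becomes
    \<open>n\<close>, and asking everything attains it.\<close>
  have b1: "h_min C n d k = n" if "k = 1 \<or> d = 1" and C: "C \<in> {AR, EAR}" for C
  proof (rule antisym)
    show "h_min C n d k \<le> n"
      using h_min_le[OF simple(1) h_le[OF simple(1)]] .
    show "n \<le> h_min C n d k"
      using AR_lower(1)[OF C] that(1) by auto
  qed

  \<comment> \<open>Averaging gives \<open>n / k ^ (d - 1)\<close>, which dominates the stated
    expression because \<open>k - 1 \<le> k\<close>.\<close>
  have b2: "real n * (real k - 1) / real k ^ d \<le> real (h_min AR n d k)"
  proof -
    have "real n \<le> real (h_min AR n d k * k ^ (d - 1))"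
      using AR_lower(1)[of AR] by (simp only: of_nat_le_iff) simp
    then have "real n / real k ^ (d - 1) \<le> real (h_min AR n d k)"
      using assms(3) by (simp add: pos_divide_le_eq)
    moreover have "real n * (real k - 1) / real k ^ d \<le> real n * real k / real k ^ d"
      by (intro divide_right_mono mult_left_mono) auto
    moreover have "real n * real k / real k ^ d = real n / real k ^ (d - 1)"
      using assms(2,3) by (cases d) (simp_all add: field_simps)
    ultimately show ?thesis
      by linarith
  qed

  \<comment> \<open>A system optimal for EAR serves as a candidate for AR.\<close>
  have b3: "h_min AR n d k \<le> h_min EAR n d k"
  proof -
    obtain S where S: "S \<in> systems n d k" "h_min EAR n d k = h EAR S"
      using h_min_attained[OF nonempty] .
    then show ?thesis
      using h_min_le[OF S(1)] h_AR_le_h_EAR params[OF S(1)] by simp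
  qed

  \<comment> \<open>With \<open>t = 1\<close> the digits have base \<open>k\<close>, and the 1 in
    the block bound completes the \<open>d - 1\<close> level queries to \<open>d\<close>.\<close>
  have b4: "real (h_min EAR n d k) \<le> real d + real n / real k ^ (d - 1)" if "2 \<le> d"
  proof -
    interpret layered n d k 1
      using that assms by unfold_locales auto
    have "h_min EAR n d k \<le> (d - 1) + (n div k ^ (d - 1) + 1)"
      using h_min_le[OF layered_system_systems] h_layered_system[of EAR] by simp
    then have "h_min EAR n d k \<le> d + n div k ^ (d - 1)"
      using assms(2) by simp
    then have "real (h_min EAR n d k) \<le> real d + real (n div k ^ (d - 1))"
      by (simp flip: of_nat_add)
    also have "real (n div k ^ (d - 1)) \<le> real n / real (k ^ (d - 1))"
      by (rule of_nat_div_le_of_nat)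
    finally show ?thesis
      by simp
  qed

  \<comment> \<open>For \<open>d = n\<close> a longest rule contains every attribute and forces
    \<open>n\<close> queries; otherwise positivity and the one-query system meet at 1.\<close>
  have c: "hR_min C n d k = (if d = n then n else 1)" if C: "C \<in> {SR, AD}" for C
  proof -
    have C': "C \<in> {SR, ESR, AD, EAD}"
      using C by auto
    obtain S where S: "S \<in> systems n d k" "minimal_rules C S" "hR_min C n d k = h C S"
      using hR_min_attained[OF simple C'] .
    show ?thesis
    proof (cases "d = n")
      case True
      have "n \<le> h C S"
        using d_of_le_h[OF _ _ S(2)] params[OF S(1)] True by simp
      then show ?thesis
        using True S(3) h_le[OF S(1), of C] by simp
    next
      case False
      have "hR_min C n d k \<le> 1"
        using h_simple_system[OF assms(2) _ assms(3) C] False assms(4)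
        by (intro hR_min_le[OF simple C']) simp
      moreover have "h C S > 0"
        using h_pos[OF _ _ S(2)] params[OF S(1)] by simp
      ultimately show ?thesis
        using S(3) False by simp
    qed
  qed

  show ?thesis
    using a b1 b2 b3 b4 c AR_lower(2)[of AR] hR_min_ESR_EAD_bounds[OF assms, of ESR]
      hR_min_ESR_EAD_bounds[OF assms, of EAD] by simp
qed

end
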